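(* Let $(M_1,g_1)$ and $(M_2,g_2)$ be two Riemannian manifolds and let $N=M_1\times M_2$ be their Riemannian product, with product metric $g$. Suppose that $\mathcal{E}_1$ is a $(\lambda_1,\mu_1)$-eigenfamily on $M_1$ and $\mathcal{E}_2$ is a $(\lambda_2,\mu_2)$-eigenfamily on $M_2$, where $\lambda_1,\mu_1,\lambda_2,\mu_2\in\mathbb{C}$. Then the set $$\mathcal{E}=\{\phi:N\to\mathbb{C}\ |\ \phi:(p_1,p_2)\mapsto\phi_1(p_1)\cdot\phi_2(p_2),\ \phi_1\in\mathcal{E}_1,\ \phi_2\in\mathcal{E}_2\}$$ is an eigenfamily on the product space $N$ and the tension field $\tau$ and conformality operator $\kappa$ on $N$ satisfy $$\tau(\phi)=(\lambda_1+\lambda_2)\cdot\phi\quad\text{and}\quad\kappa(\phi,\psi)=(\mu_1+\mu_2)\cdot\phi\,\psi$$ for all $\phi,\psi\in\mathcal{E}$.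
   Context: For a Riemannian manifold $(M,g)$, extend $g$ complex-bilinearly to the complexified tangent bundle. For (sufficiently smooth) functions $\phi,\psi:M\to\mathbb{C}$ put $\tau(\phi)=\operatorname{div}(\nabla\phi)$ (tension field, i.e. Laplace-Beltrami operator) and $\kappa(\phi,\psi)=g(\nabla\phi,\nabla\psi)$ (conformality operator, complex bilinear). A set $\mathcal{E}$ of functions $M\to\mathbb{C}$ is a $(\lambda,\mu)$-eigenfamily, for $\lambda,\mu\in\mathbb{C}$, if $\tau(\phi)=\lambda\phi$ and $\kappa(\phi,\psi)=\mu\,\phi\,\psi$ for all $\phi,\psi\in\mathcal{E}$. *)

theory Defs
  imports "HOL-Analysis.Analysis"
begin

section \<open>Functions of class \<open>C\<^sup>k\<close> on open subsets of normed spaces\<close>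

text \<open>Meant for open \<open>S\<close>; the last clause runs over all directional derivatives of \<open>f\<close>.\<close>

primrec Ck_on :: "nat \<Rightarrow> 'a::real_normed_vector set \<Rightarrow> ('a \<Rightarrow> 'b::real_normed_vector) \<Rightarrow> bool" where
  "Ck_on 0 S f \<longleftrightarrow> continuous_on S f"
| "Ck_on (Suc k) S f \<longleftrightarrow>
     (\<forall>x\<in>S. f differentiable (at x)) \<and>
     (\<forall>v. Ck_on k S (\<lambda>x. frechet_derivative f (at x) v))"

definition smooth_on :: "'a::real_normed_vector set \<Rightarrow> ('a \<Rightarrow> 'b::real_normed_vector) \<Rightarrow> bool" where
  "smooth_on S f \<longleftrightarrow> (\<forall>k. Ck_on k S f)"


section \<open>Riemannian manifolds\<close>

text \<open>
  The atlas is an indexed family of charts, not assumed to be maximal. A chart maps an open set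
  \<open>chart_dom M i\<close> of \<open>M\<close> onto an open subset of the Euclidean space \<open>'e\<close> (so \<open>dim M = DIM('e)\<close>).
  Only the values of \<open>chart_map M i\<close> on \<open>chart_dom M i\<close> matter.

  A tangent vector at \<open>p\<close> is given by its components in \<open>'e\<close> with respect to the charts around
  \<open>p\<close>, and \<open>riem_metric M i p v w\<close> is the metric applied to the tangent vectors at \<open>p\<close> which have the
  components \<open>v\<close> and \<open>w\<close> in the chart \<open>i\<close>.
\<close>

record ('a, 'i, 'e) riem_mfd =
  mtop :: "'a topology"
  chart_idx :: "'i set"
  chart_dom :: "'i \<Rightarrow> 'a set"
  chart_map :: "'i \<Rightarrow> 'a \<Rightarrow> 'e"
  riem_metric :: "'i \<Rightarrow> 'a \<Rightarrow> 'e \<Rightarrow> 'e \<Rightarrow> real"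

abbreviation points :: "('a, 'i, 'e) riem_mfd \<Rightarrow> 'a set" where
  "points M \<equiv> topspace (mtop M)"

definition chart_img :: "('a, 'i, 'e) riem_mfd \<Rightarrow> 'i \<Rightarrow> 'e set" where
  "chart_img M i = chart_map M i ` chart_dom M i"

definition chart_inv :: "('a, 'i, 'e) riem_mfd \<Rightarrow> 'i \<Rightarrow> 'e \<Rightarrow> 'a" where
  "chart_inv M i = inv_into (chart_dom M i) (chart_map M i)"

definition transition :: "('a, 'i, 'e) riem_mfd \<Rightarrow> 'i \<Rightarrow> 'i \<Rightarrow> 'e \<Rightarrow> 'e" where
  "transition M i j = chart_map M j \<circ> chart_inv M i"

locale riemannian_manifold =
  fixes M :: "('a, 'i, 'e::euclidean_space) riem_mfd"
  assumes Hausdorff: "Hausdorff_space (mtop M)"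
    and second_countable: "second_countable (mtop M)"
    and open_chart_dom: "i \<in> chart_idx M \<Longrightarrow> openin (mtop M) (chart_dom M i)"
    and charts_cover: "points M = (\<Union>i\<in>chart_idx M. chart_dom M i)"
    and open_chart_img: "i \<in> chart_idx M \<Longrightarrow> open (chart_img M i)"
    and homeomorphic_chart: "i \<in> chart_idx M \<Longrightarrow>
      homeomorphic_map (subtopology (mtop M) (chart_dom M i)) (top_of_set (chart_img M i))
        (chart_map M i)"
    and smooth_transition: "i \<in> chart_idx M \<Longrightarrow> j \<in> chart_idx M \<Longrightarrow>
      smooth_on (chart_map M i ` (chart_dom M i \<inter> chart_dom M j)) (transition M i j)"
    and metric_bilinear: "i \<in> chart_idx M \<Longrightarrow> p \<in> chart_dom M i \<Longrightarrow> bilinear (riem_metric M i p)"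
    and metric_sym: "i \<in> chart_idx M \<Longrightarrow> p \<in> chart_dom M i \<Longrightarrow>
      riem_metric M i p v w = riem_metric M i p w v"
    and metric_pos: "i \<in> chart_idx M \<Longrightarrow> p \<in> chart_dom M i \<Longrightarrow> v \<noteq> 0 \<Longrightarrow> 0 < riem_metric M i p v v"
    and metric_smooth: "i \<in> chart_idx M \<Longrightarrow>
      smooth_on (chart_img M i) (\<lambda>x. riem_metric M i (chart_inv M i x) v w)"
    and metric_transform: "i \<in> chart_idx M \<Longrightarrow> j \<in> chart_idx M \<Longrightarrow>
      p \<in> chart_dom M i \<inter> chart_dom M j \<Longrightarrow>
      riem_metric M i p v w =
        riem_metric M j p (frechet_derivative (transition M i j) (at (chart_map M i p)) v)
                     (frechet_derivative (transition M i j) (at (chart_map M i p)) w)"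

definition Ck_on_mfd ::
  "nat \<Rightarrow> ('a, 'i, 'e::euclidean_space) riem_mfd \<Rightarrow> ('a \<Rightarrow> 'b::real_normed_vector) \<Rightarrow> bool" where
  "Ck_on_mfd k M f \<longleftrightarrow> (\<forall>i\<in>chart_idx M. Ck_on k (chart_img M i) (f \<circ> chart_inv M i))"


section \<open>Gradient, Levi-Civita connection and divergence\<close>

text \<open>
  A vector field \<open>X\<close> is the family of its local representations: \<open>X i p\<close> is the component vector
  at \<open>p\<close> in the chart \<open>i\<close>.
\<close>

text \<open>\<open>g(\<nabla>f, w) = df(w)\<close>\<close>

definition grad :: "('a, 'i, 'e::euclidean_space) riem_mfd \<Rightarrow> ('a \<Rightarrow> real) \<Rightarrow> 'i \<Rightarrow> 'a \<Rightarrow> 'e" where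
  "grad M f i p = (THE v. \<forall>w. riem_metric M i p v w =
     frechet_derivative (f \<circ> chart_inv M i) (at (chart_map M i p)) w)"

text \<open>\<open>metric_deriv M i p u v w\<close> is \<open>\<partial>\<^sub>u g(v, w)\<close> for constant \<open>u, v, w\<close> in the chart \<open>i\<close>.\<close>

definition metric_deriv ::
  "('a, 'i, 'e::euclidean_space) riem_mfd \<Rightarrow> 'i \<Rightarrow> 'a \<Rightarrow> 'e \<Rightarrow> 'e \<Rightarrow> 'e \<Rightarrow> real" where
  "metric_deriv M i p u v w =
     frechet_derivative (\<lambda>x. riem_metric M i (chart_inv M i x) v w) (at (chart_map M i p)) u"

text \<open>
  The Koszul formula for coordinate vector fields, whose Lie brackets vanish. In components,
  \<open>christoffel M i p\<close> maps \<open>(e\<^sub>a, e\<^sub>b)\<close> to the vector with entries \<open>\<Gamma>\<^sup>c\<^sub>a\<^sub>b\<close>.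
\<close>

definition christoffel ::
  "('a, 'i, 'e::euclidean_space) riem_mfd \<Rightarrow> 'i \<Rightarrow> 'a \<Rightarrow> 'e \<Rightarrow> 'e \<Rightarrow> 'e" where
  "christoffel M i p u v = (THE z. \<forall>w. riem_metric M i p z w =
     (metric_deriv M i p u v w + metric_deriv M i p v u w - metric_deriv M i p w u v) / 2)"

text \<open>\<open>levi_civita M X i p u\<close> is \<open>\<nabla>\<^sub>u X\<close> at \<open>p\<close> in the chart \<open>i\<close>.\<close>

definition levi_civita ::
  "('a, 'i, 'e::euclidean_space) riem_mfd \<Rightarrow> ('i \<Rightarrow> 'a \<Rightarrow> 'e) \<Rightarrow> 'i \<Rightarrow> 'a \<Rightarrow> 'e \<Rightarrow> 'e" where
  "levi_civita M X i p u =
     frechet_derivative (\<lambda>x. X i (chart_inv M i x)) (at (chart_map M i p)) u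
     + christoffel M i p u (X i p)"

definition lin_trace :: "('e::euclidean_space \<Rightarrow> 'e) \<Rightarrow> real" where
  "lin_trace L = (\<Sum>b\<in>Basis. L b \<bullet> b)"

text \<open>
  The scalar quantities below are evaluated in an arbitrary chart around the point; they are
  independent of the chart.
\<close>

definition chart_at :: "('a, 'i, 'e) riem_mfd \<Rightarrow> 'a \<Rightarrow> 'i" where
  "chart_at M p = (SOME i. i \<in> chart_idx M \<and> p \<in> chart_dom M i)"

text \<open>\<open>div X = tr (u \<mapsto> \<nabla>\<^sub>u X)\<close>\<close>

definition divergence ::
  "('a, 'i, 'e::euclidean_space) riem_mfd \<Rightarrow> ('i \<Rightarrow> 'a \<Rightarrow> 'e) \<Rightarrow> 'a \<Rightarrow> real" where
  "divergence M X p = lin_trace (levi_civita M X (chart_at M p) p)"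


section \<open>Complexification\<close>

text \<open>\<open>CVec X Y\<close> stands for the complexified tangent vector \<open>X + \<i>Y\<close>.\<close>

datatype 'e cvec = CVec (re_vec: 'e) (im_vec: 'e)

text \<open>The complex bilinear (not Hermitian) extension of the metric.\<close>

definition cmetric ::
  "('a, 'i, 'e) riem_mfd \<Rightarrow> 'i \<Rightarrow> 'a \<Rightarrow> 'e cvec \<Rightarrow> 'e cvec \<Rightarrow> complex" where
  "cmetric M i p Z W = Complex
     (riem_metric M i p (re_vec Z) (re_vec W) - riem_metric M i p (im_vec Z) (im_vec W))
     (riem_metric M i p (re_vec Z) (im_vec W) + riem_metric M i p (im_vec Z) (re_vec W))"

definition cgrad ::
  "('a, 'i, 'e::euclidean_space) riem_mfd \<Rightarrow> ('a \<Rightarrow> complex) \<Rightarrow> 'i \<Rightarrow> 'a \<Rightarrow> 'e cvec" where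
  "cgrad M \<phi> i p = CVec (grad M (\<lambda>q. Re (\<phi> q)) i p) (grad M (\<lambda>q. Im (\<phi> q)) i p)"

definition cdivergence ::
  "('a, 'i, 'e::euclidean_space) riem_mfd \<Rightarrow> ('i \<Rightarrow> 'a \<Rightarrow> 'e cvec) \<Rightarrow> 'a \<Rightarrow> complex" where
  "cdivergence M Z p = Complex
     (divergence M (\<lambda>i q. re_vec (Z i q)) p) (divergence M (\<lambda>i q. im_vec (Z i q)) p)"


section \<open>Eigenfamilies\<close>

definition tension ::
  "('a, 'i, 'e::euclidean_space) riem_mfd \<Rightarrow> ('a \<Rightarrow> complex) \<Rightarrow> 'a \<Rightarrow> complex" where
  "tension M \<phi> = cdivergence M (cgrad M \<phi>)"

definition conformality ::
  "('a, 'i, 'e::euclidean_space) riem_mfd \<Rightarrow> ('a \<Rightarrow> complex) \<Rightarrow> ('a \<Rightarrow> complex) \<Rightarrow> 'a \<Rightarrow> complex" where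
  "conformality M \<phi> \<psi> p =
     cmetric M (chart_at M p) p (cgrad M \<phi> (chart_at M p) p) (cgrad M \<psi> (chart_at M p) p)"

definition eigenfamily ::
  "('a, 'i, 'e::euclidean_space) riem_mfd \<Rightarrow> complex \<Rightarrow> complex \<Rightarrow> ('a \<Rightarrow> complex) set \<Rightarrow> bool" where
  "eigenfamily M lam \<mu> \<E> \<longleftrightarrow>
     (\<forall>\<phi>\<in>\<E>. Ck_on_mfd 2 M \<phi>) \<and>
     (\<forall>\<phi>\<in>\<E>. \<forall>p\<in>points M. tension M \<phi> p = lam * \<phi> p) \<and>
     (\<forall>\<phi>\<in>\<E>. \<forall>\<psi>\<in>\<E>. \<forall>p\<in>points M. conformality M \<phi> \<psi> p = \<mu> * \<phi> p * \<psi> p)"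


section \<open>Riemannian products\<close>

definition riemannian_product ::
  "('a, 'i, 'e) riem_mfd \<Rightarrow> ('b, 'j, 'f) riem_mfd \<Rightarrow> ('a \<times> 'b, 'i \<times> 'j, 'e \<times> 'f) riem_mfd" where
  "riemannian_product M1 M2 = \<lparr>
     mtop = prod_topology (mtop M1) (mtop M2),
     chart_idx = chart_idx M1 \<times> chart_idx M2,
     chart_dom = (\<lambda>(i, j). chart_dom M1 i \<times> chart_dom M2 j),
     chart_map = (\<lambda>(i, j). map_prod (chart_map M1 i) (chart_map M2 j)),
     riem_metric = (\<lambda>(i, j) (p, q) (v1, v2) (w1, w2). riem_metric M1 i p v1 w1 + riem_metric M2 j q v2 w2) \<rparr>"


subsection \<open>The product of Riemannian manifolds is a Riemannian manifold\<close>

lemma Ck_on_cong: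
  assumes "open S" "\<And>x. x \<in> S \<Longrightarrow> f x = g x" "Ck_on k S f"
  shows "Ck_on k S g"
  using assms(2,3)
proof (induction k arbitrary: f g)
  case 0
  then show ?case by (simp cong: continuous_on_cong)
next
  case (Suc k)
  have der: "(g has_derivative frechet_derivative f (at x)) (at x)" if "x \<in> S" for x
  proof (rule has_derivative_transform_within_open[of f _ x UNIV S])
    show "(f has_derivative frechet_derivative f (at x)) (at x)"
      using Suc.prems that by (simp flip: frechet_derivative_works)
  qed (use Suc.prems that \<open>open S\<close> in auto)
  have eq: "frechet_derivative f (at x) = frechet_derivative g (at x)" if "x \<in> S" for x
    using der[OF that] by (rule frechet_derivative_at)
  have "g differentiable (at x)" if "x \<in> S" for x
    using der[OF that] by (auto simp: differentiable_def)
  moreover have "Ck_on k S (\<lambda>x. frechet_derivative g (at x) v)" for v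
    by (rule Suc.IH[of "\<lambda>x. frechet_derivative f (at x) v"]) (use Suc.prems eq in auto)
  ultimately show ?case by simp
qed

lemma Ck_on_combine:
  fixes h :: "'c::real_normed_vector \<times> 'd::real_normed_vector \<Rightarrow> 'z::real_normed_vector"
  assumes h: "bounded_linear h" and S: "open S" and T: "open T"
  shows "Ck_on k S f \<Longrightarrow> Ck_on k T g \<Longrightarrow> Ck_on k (S \<times> T) (\<lambda>z. h (f (fst z), g (snd z)))"
proof (induction k arbitrary: f g)
  case 0
  then have "continuous_on (S \<times> T) (\<lambda>z. f (fst z))" "continuous_on (S \<times> T) (\<lambda>z. g (snd z))"
    by (auto intro!: continuous_on_compose2[of S f] continuous_on_compose2[of T g] continuous_intros)
  then show ?case
    by (auto intro!: bounded_linear.continuous_on[OF h] continuous_intros)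
next
  case (Suc k)
  let ?D = "\<lambda>z v. h (frechet_derivative f (at (fst z)) (fst v), frechet_derivative g (at (snd z)) (snd v))"
  have der: "((\<lambda>z. h (f (fst z), g (snd z))) has_derivative ?D z) (at z)" if "z \<in> S \<times> T" for z
  proof -
    have "(f has_derivative frechet_derivative f (at (fst z))) (at (fst z))"
      "(g has_derivative frechet_derivative g (at (snd z))) (at (snd z))"
      using Suc.prems that by (auto simp flip: frechet_derivative_works)
    then show ?thesis
      by (intro bounded_linear.has_derivative[OF h] has_derivative_Pair
            has_derivative_compose[of fst fst z UNIV f] has_derivative_compose[of snd snd z UNIV g]
            bounded_linear_imp_has_derivative bounded_linear_fst bounded_linear_snd)
  qed
  have eq: "?D z = frechet_derivative (\<lambda>z. h (f (fst z), g (snd z))) (at z)" if "z \<in> S \<times> T" for z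
    using der[OF that] by (rule frechet_derivative_at)
  have "Ck_on k (S \<times> T) (\<lambda>z. frechet_derivative (\<lambda>z. h (f (fst z), g (snd z))) (at z) v)" for v
  proof (rule Ck_on_cong[of _ "\<lambda>z. ?D z v"])
    show "open (S \<times> T)" using S T by (rule open_Times)
    show "Ck_on k (S \<times> T) (\<lambda>z. ?D z v)"
      using Suc.IH[of "\<lambda>x. frechet_derivative f (at x) (fst v)" "\<lambda>y. frechet_derivative g (at y) (snd v)"]
        Suc.prems by simp
    show "?D z v = frechet_derivative (\<lambda>z. h (f (fst z), g (snd z))) (at z) v" if "z \<in> S \<times> T" for z
      using fun_cong[OF eq[OF that], of v] .
  qed
  moreover have "(\<lambda>z. h (f (fst z), g (snd z))) differentiable (at z)" if "z \<in> S \<times> T" for z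
    using der[OF that] by (rule differentiableI)
  ultimately show ?case by simp
qed

lemma second_countable_prod:
  assumes "second_countable X" "second_countable Y"
  shows "second_countable (prod_topology X Y)"
proof -
  obtain B where B: "countable B" "\<And>V. V \<in> B \<Longrightarrow> openin X V"
    "\<And>U x. openin X U \<Longrightarrow> x \<in> U \<Longrightarrow> \<exists>V\<in>B. x \<in> V \<and> V \<subseteq> U"
    using assms(1) unfolding second_countable_def by metis
  obtain C where C: "countable C" "\<And>V. V \<in> C \<Longrightarrow> openin Y V"
    "\<And>U x. openin Y U \<Longrightarrow> x \<in> U \<Longrightarrow> \<exists>V\<in>C. x \<in> V \<and> V \<subseteq> U"
    using assms(2) unfolding second_countable_def by metis
  let ?P = "(\<lambda>(U, V). U \<times> V) ` (B \<times> C)"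
  have "\<exists>V\<in>?P. z \<in> V \<and> V \<subseteq> W" if W: "openin (prod_topology X Y) W" "z \<in> W" for W z
  proof -
    obtain x y where z: "z = (x, y)" by (cases z)
    obtain U V where UV: "openin X U" "openin Y V" "x \<in> U" "y \<in> V" "U \<times> V \<subseteq> W"
      using iffD1[OF openin_prod_topology_alt W(1), rule_format, OF W(2)[unfolded z]] by metis
    obtain U' where "U' \<in> B" "x \<in> U'" "U' \<subseteq> U" using B(3) UV by blast
    moreover obtain V' where "V' \<in> C" "y \<in> V'" "V' \<subseteq> V" using C(3) UV by blast
    ultimately show ?thesis
      using UV z by (intro bexI[of _ "U' \<times> V'"]) auto
  qed
  then show ?thesis
    unfolding second_countable_def using B C
    by (intro exI[of _ ?P]) (auto simp: openin_prod_Times_iff)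
qed

lemma riemannian_product_simps [simp]:
  "mtop (riemannian_product M1 M2) = prod_topology (mtop M1) (mtop M2)"
  "chart_idx (riemannian_product M1 M2) = chart_idx M1 \<times> chart_idx M2"
  "chart_dom (riemannian_product M1 M2) (i, j) = chart_dom M1 i \<times> chart_dom M2 j"
  "chart_map (riemannian_product M1 M2) (i, j) = map_prod (chart_map M1 i) (chart_map M2 j)"
  "riem_metric (riemannian_product M1 M2) (i, j) (p, q) v w =
     riem_metric M1 i p (fst v) (fst w) + riem_metric M2 j q (snd v) (snd w)"
  "chart_img (riemannian_product M1 M2) (i, j) = chart_img M1 i \<times> chart_img M2 j"
  by (auto simp: riemannian_product_def chart_img_def case_prod_beta map_prod_def image_iff
           intro!: image_eqI)

context riemannian_manifold
begin

lemma inj_on_chart: "i \<in> chart_idx M \<Longrightarrow> inj_on (chart_map M i) (chart_dom M i)"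
  using homeomorphic_imp_injective_map[OF homeomorphic_chart] open_chart_dom
  by (metis openin_subset topspace_subtopology_subset)

lemma chart_inv_chart: "i \<in> chart_idx M \<Longrightarrow> p \<in> chart_dom M i \<Longrightarrow> chart_inv M i (chart_map M i p) = p"
  by (simp add: chart_inv_def inj_on_chart)

lemma open_transition_dom:
  assumes "i \<in> chart_idx M" "j \<in> chart_idx M"
  shows "open (chart_map M i ` (chart_dom M i \<inter> chart_dom M j))"
proof -
  have "openin (subtopology (mtop M) (chart_dom M i)) (chart_dom M i \<inter> chart_dom M j)"
    using open_chart_dom assms openin_subtopology_Int2 by blast
  then have "openin (top_of_set (chart_img M i)) (chart_map M i ` (chart_dom M i \<inter> chart_dom M j))"
    using homeomorphic_imp_open_map[OF homeomorphic_chart[OF assms(1)]] by (simp add: open_map_def)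
  then show ?thesis
    using openin_open_trans open_chart_img assms(1) by blast
qed

lemma transition_differentiable:
  assumes "i \<in> chart_idx M" "j \<in> chart_idx M" "p \<in> chart_dom M i \<inter> chart_dom M j"
  shows "transition M i j differentiable (at (chart_map M i p))"
proof -
  have "Ck_on (Suc 0) (chart_map M i ` (chart_dom M i \<inter> chart_dom M j)) (transition M i j)"
    using smooth_transition[OF assms(1,2)] unfolding smooth_on_def by blast
  then show ?thesis using assms(3) by auto
qed

end

lemma top_of_set_Times:
  fixes S :: "'a::topological_space set" and T :: "'b::topological_space set"
  shows "top_of_set (S \<times> T) = prod_topology (top_of_set S) (top_of_set T)"
proof -
  have "prod_topology euclidean euclidean = (euclidean :: ('a \<times> 'b) topology)"
    by (auto simp: topology_eq openin_prod_topology_alt open_prod_def mem_Times_iff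
        subset_iff Ball_def)
  then show ?thesis by (metis subtopology_Times)
qed

lemma homeomorphic_map_prod:
  assumes "homeomorphic_map X X' f" "homeomorphic_map Y Y' g"
  shows "homeomorphic_map (prod_topology X Y) (prod_topology X' Y') (map_prod f g)"
proof -
  obtain f' g' where "homeomorphic_maps X X' f f'" "homeomorphic_maps Y Y' g g'"
    using assms unfolding homeomorphic_map_maps by blast
  then have "homeomorphic_maps (prod_topology X Y) (prod_topology X' Y')
      (\<lambda>(x, y). (f x, g y)) (\<lambda>(x, y). (f' x, g' y))"
    by (simp add: homeomorphic_maps_prod)
  then show ?thesis
    unfolding homeomorphic_map_maps map_prod_def by blast
qed

theorem riemannian_manifold_product:
  assumes "riemannian_manifold M1" "riemannian_manifold M2"
  shows "riemannian_manifold (riemannian_product M1 M2)"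
proof -
  interpret M1: riemannian_manifold M1 by fact
  interpret M2: riemannian_manifold M2 by fact
  let ?N = "riemannian_product M1 M2"
  have inv: "chart_inv ?N (i, j) (x, y) = (chart_inv M1 i x, chart_inv M2 j y)"
    if ij: "i \<in> chart_idx M1" "j \<in> chart_idx M2" and x: "x \<in> chart_img M1 i" and y: "y \<in> chart_img M2 j"
    for i j x y
  proof -
    obtain p q where "p \<in> chart_dom M1 i" "x = chart_map M1 i p" "q \<in> chart_dom M2 j" "y = chart_map M2 j q"
      using x y by (auto simp: chart_img_def)
    moreover have "inj_on (map_prod (chart_map M1 i) (chart_map M2 j)) (chart_dom M1 i \<times> chart_dom M2 j)"
      using M1.inj_on_chart M2.inj_on_chart ij by (intro map_prod_inj_on)
    ultimately show ?thesis
      using ij inv_into_f_f[of "map_prod (chart_map M1 i) (chart_map M2 j)" "chart_dom M1 i \<times> chart_dom M2 j" "(p, q)"]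
      by (simp add: M1.chart_inv_chart M2.chart_inv_chart) (simp add: chart_inv_def)
  qed
  have trans: "transition ?N (i, j) (k, l) z = (transition M1 i k (fst z), transition M2 j l (snd z))"
    if "i \<in> chart_idx M1" "j \<in> chart_idx M2" "z \<in> chart_img M1 i \<times> chart_img M2 j" for i j k l z
    using that inv[of i j "fst z" "snd z"] by (auto simp: transition_def)
  have dom: "map_prod (chart_map M1 i) (chart_map M2 j) ` (chart_dom M1 i \<times> chart_dom M2 j \<inter> chart_dom M1 k \<times> chart_dom M2 l)
     = chart_map M1 i ` (chart_dom M1 i \<inter> chart_dom M1 k) \<times> chart_map M2 j ` (chart_dom M2 j \<inter> chart_dom M2 l)"
    for i j k l
    by (simp add: Times_Int_Times) (force simp: map_prod_def)
  have trans_smooth: "smooth_on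
      (chart_map M1 i ` (chart_dom M1 i \<inter> chart_dom M1 k) \<times> chart_map M2 j ` (chart_dom M2 j \<inter> chart_dom M2 l))
      (transition ?N (i, j) (k, l))"
    if "i \<in> chart_idx M1" "j \<in> chart_idx M2" "k \<in> chart_idx M1" "l \<in> chart_idx M2" for i j k l
    unfolding smooth_on_def
  proof
    fix n
    have "Ck_on n (chart_map M1 i ` (chart_dom M1 i \<inter> chart_dom M1 k) \<times> chart_map M2 j ` (chart_dom M2 j \<inter> chart_dom M2 l))
       (\<lambda>z. (\<lambda>x. x) (transition M1 i k (fst z), transition M2 j l (snd z)))"
      using M1.smooth_transition M2.smooth_transition that
      by (intro Ck_on_combine M1.open_transition_dom M2.open_transition_dom bounded_linear_ident)
         (auto simp: smooth_on_def)
    then show "Ck_on n (chart_map M1 i ` (chart_dom M1 i \<inter> chart_dom M1 k) \<times> chart_map M2 j ` (chart_dom M2 j \<inter> chart_dom M2 l))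
      (transition ?N (i, j) (k, l))"
    proof (rule Ck_on_cong[rotated 2], goal_cases)
      case 1
      show ?case
        using that by (intro open_Times M1.open_transition_dom M2.open_transition_dom)
    next
      case (2 z)
      then have "z \<in> chart_img M1 i \<times> chart_img M2 j" by (auto simp: chart_img_def)
      then show ?case using trans that by simp
    qed
  qed
  have trans_deriv: "frechet_derivative (transition ?N (i, j) (k, l)) (at (chart_map M1 i p, chart_map M2 j q)) v
      = (frechet_derivative (transition M1 i k) (at (chart_map M1 i p)) (fst v),
         frechet_derivative (transition M2 j l) (at (chart_map M2 j q)) (snd v))"
    if i: "i \<in> chart_idx M1" "k \<in> chart_idx M1" "p \<in> chart_dom M1 i \<inter> chart_dom M1 k"
      and j: "j \<in> chart_idx M2" "l \<in> chart_idx M2" "q \<in> chart_dom M2 j \<inter> chart_dom M2 l" for i j k l p q v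
  proof -
    let ?z = "(chart_map M1 i p, chart_map M2 j q)"
    let ?D = "\<lambda>v. (frechet_derivative (transition M1 i k) (at (fst ?z)) (fst v),
         frechet_derivative (transition M2 j l) (at (snd ?z)) (snd v))"
    have "((\<lambda>z. (transition M1 i k (fst z), transition M2 j l (snd z))) has_derivative ?D) (at ?z)"
      using M1.transition_differentiable[OF i] M2.transition_differentiable[OF j]
      by (intro has_derivative_Pair has_derivative_compose[of fst fst ?z UNIV "transition M1 i k"]
            has_derivative_compose[of snd snd ?z UNIV "transition M2 j l"]
            bounded_linear_imp_has_derivative bounded_linear_fst bounded_linear_snd)
         (simp_all flip: frechet_derivative_works)
    then have "(transition ?N (i, j) (k, l) has_derivative ?D) (at ?z)"
      by (rule has_derivative_transform_within_open[of _ _ _ _ "chart_img M1 i \<times> chart_img M2 j"])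
         (use i j M1.open_chart_img M2.open_chart_img trans in \<open>auto simp: chart_img_def open_Times\<close>)
    from fun_cong[OF frechet_derivative_at[OF this], of v] show ?thesis by simp
  qed
  show ?thesis
  proof
    show "Hausdorff_space (mtop ?N)"
      using M1.Hausdorff M2.Hausdorff by (simp add: Hausdorff_space_prod_topology)
    show "second_countable (mtop ?N)"
      using M1.second_countable M2.second_countable by (simp add: second_countable_prod)
    show "points ?N = (\<Union>i\<in>chart_idx ?N. chart_dom ?N i)"
      using M1.charts_cover M2.charts_cover by auto
  next
    fix a assume "a \<in> chart_idx ?N"
    then obtain i j where a: "a = (i, j)" and ij: "i \<in> chart_idx M1" "j \<in> chart_idx M2" by auto
    show "openin (mtop ?N) (chart_dom ?N a)"
      using a ij M1.open_chart_dom M2.open_chart_dom by (simp add: openin_prod_Times_iff)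
    show "open (chart_img ?N a)"
      using a ij M1.open_chart_img M2.open_chart_img by (simp add: open_Times)
    show "homeomorphic_map (subtopology (mtop ?N) (chart_dom ?N a)) (top_of_set (chart_img ?N a)) (chart_map ?N a)"
      unfolding a riemannian_product_simps subtopology_Times top_of_set_Times
      by (rule homeomorphic_map_prod[OF M1.homeomorphic_chart[OF ij(1)] M2.homeomorphic_chart[OF ij(2)]])
    fix v w
    have "smooth_on (chart_img M1 i \<times> chart_img M2 j)
      (\<lambda>x. riem_metric ?N (i, j) (chart_inv ?N (i, j) x) v w)"
      unfolding smooth_on_def
    proof
      fix n
      have "Ck_on n (chart_img M1 i \<times> chart_img M2 j)
        (\<lambda>z. (\<lambda>x. fst x + snd x) (riem_metric M1 i (chart_inv M1 i (fst z)) (fst v) (fst w),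
                riem_metric M2 j (chart_inv M2 j (snd z)) (snd v) (snd w)))"
        using M1.metric_smooth[OF ij(1)] M2.metric_smooth[OF ij(2)] ij
        by (intro Ck_on_combine M1.open_chart_img M2.open_chart_img bounded_linear_add
              bounded_linear_fst bounded_linear_snd)
           (auto simp: smooth_on_def)
      then show "Ck_on n (chart_img M1 i \<times> chart_img M2 j)
          (\<lambda>x. riem_metric ?N (i, j) (chart_inv ?N (i, j) x) v w)"
        using ij M1.open_chart_img M2.open_chart_img
        by (elim Ck_on_cong[rotated 2]) (auto intro!: open_Times simp: inv)
    qed
    then show "smooth_on (chart_img ?N a) (\<lambda>x. riem_metric ?N a (chart_inv ?N a x) v w)"
      using a by simp
  next
    fix a p assume "a \<in> chart_idx ?N" and p: "p \<in> chart_dom ?N a"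
    then obtain i j where a: "a = (i, j)" and ij: "i \<in> chart_idx M1" "j \<in> chart_idx M2" by auto
    obtain p1 p2 where p: "p = (p1, p2)" "p1 \<in> chart_dom M1 i" "p2 \<in> chart_dom M2 j"
      using p a by auto
    note b = M1.metric_bilinear[OF ij(1) p(2)] M2.metric_bilinear[OF ij(2) p(3)]
    show "bilinear (riem_metric ?N a p)"
      using b unfolding bilinear_def linear_iff a p(1) riemannian_product_simps
      by (simp add: distrib_left)
    fix v w
    show "riem_metric ?N a p v w = riem_metric ?N a p w v"
      unfolding a p(1) riemannian_product_simps
      using M1.metric_sym[OF ij(1) p(2)] M2.metric_sym[OF ij(2) p(3)] by metis
    have "riem_metric M1 i p1 0 0 = 0" "riem_metric M2 j p2 0 0 = 0"
      using b by (auto simp: bilinear_lzero)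
    then show "0 < riem_metric ?N a p v v" if "v \<noteq> 0"
      using that M1.metric_pos[OF ij(1) p(2)] M2.metric_pos[OF ij(2) p(3)]
      by (cases v; cases "fst v = 0"; cases "snd v = 0") (auto simp: a p(1) zero_prod_def intro: add_pos_pos)
  next
    fix a b assume "a \<in> chart_idx ?N" "b \<in> chart_idx ?N"
    then obtain i j k l where ab: "a = (i, j)" "b = (k, l)"
      and ij: "i \<in> chart_idx M1" "j \<in> chart_idx M2" "k \<in> chart_idx M1" "l \<in> chart_idx M2" by auto
    show "smooth_on (chart_map ?N a ` (chart_dom ?N a \<inter> chart_dom ?N b)) (transition ?N a b)"
      using trans_smooth[OF ij] by (simp add: ab dom)
    fix p v w assume "p \<in> chart_dom ?N a \<inter> chart_dom ?N b"
    then obtain p1 p2 where p: "p = (p1, p2)" "p1 \<in> chart_dom M1 i \<inter> chart_dom M1 k"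
      "p2 \<in> chart_dom M2 j \<inter> chart_dom M2 l"
      using ab by auto
    show "riem_metric ?N a p v w =
        riem_metric ?N b p (frechet_derivative (transition ?N a b) (at (chart_map ?N a p)) v)
                      (frechet_derivative (transition ?N a b) (at (chart_map ?N a p)) w)"
      unfolding ab p(1) riemannian_product_simps map_prod_simp trans_deriv[OF ij(1,3) p(2) ij(2,4) p(3)]
        fst_conv snd_conv
      by (intro arg_cong2[where f = "(+)"] M1.metric_transform[OF ij(1,3) p(2)]
            M2.metric_transform[OF ij(2,4) p(3)])
  qed
qed

end

theory Submission
  imports Defs
begin

text \<open>
  For real functions \<open>f\<close> on \<open>M\<^sub>1\<close> and \<open>g\<close> on \<open>M\<^sub>2\<close> the gradient of \<open>f g\<close> on the product is
  \<open>(g grad f, f grad g)\<close>, and the Levi-Civita connection of the product is block diagonal. Hence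
  \<open>div grad (f g) = g div grad f + f div grad g\<close>, and the inner product of two such gradients splits
  in the same way; complex bilinearity gives the formulas for complex functions. The chart which the
  definitions choose around a point \<open>(p, q)\<close> need not be the product of the charts chosen around \<open>p\<close>
  and \<open>q\<close>, so the Laplacian and the conformality operator must be shown to be independent of the
  chart. For this the second derivative of a transition map must be symmetric and the gradient of a
  \<open>C\<^sup>2\<close> function must be differentiable.
\<close>

section \<open>Calculus\<close>

lemma Ck_on_mono_Suc: "Ck_on (Suc k) S f \<Longrightarrow> Ck_on k S f"
proof (induction k arbitrary: f)
  case 0
  then show ?case
    by (simp add: continuous_at_imp_continuous_on differentiable_imp_continuous_within)
next
  case (Suc k)
  then show ?case by (metis Ck_on.simps(2))
qed

lemma has_derivative_frechet:
  "f differentiable (at x) \<Longrightarrow> (f has_derivative frechet_derivative f (at x)) (at x)"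
  by (simp flip: frechet_derivative_works)

lemma frechet_derivative_eqI:
  "(f has_derivative f') (at x) \<Longrightarrow> frechet_derivative f (at x) = f'"
  by (rule frechet_derivative_at[symmetric])

lemma frechet_derivative_cong:
  assumes "open S" "x \<in> S" "\<And>y. y \<in> S \<Longrightarrow> f y = g y" "f differentiable (at x)"
  shows "frechet_derivative f (at x) = frechet_derivative g (at x)"
proof -
  have "(g has_derivative frechet_derivative f (at x)) (at x)"
    by (rule has_derivative_transform_within_open[OF has_derivative_frechet]) (use assms in auto)
  then show ?thesis by (rule frechet_derivative_at)
qed

lemma differentiable_bounded_linear:
  "bounded_linear h \<Longrightarrow> f differentiable (at x) \<Longrightarrow> (\<lambda>x. h (f x)) differentiable (at x)"
  using bounded_linear.has_derivative by (force simp: differentiable_def)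

lemma frechet_derivative_bounded_linear:
  assumes "bounded_linear h" "f differentiable (at x)"
  shows "frechet_derivative (\<lambda>x. h (f x)) (at x) v = h (frechet_derivative f (at x) v)"
  using frechet_derivative_eqI[OF bounded_linear.has_derivative[OF assms(1)
        has_derivative_frechet[OF assms(2)]]] by simp

lemma Ck_on_bounded_linear:
  assumes h: "bounded_linear h" and S: "open S"
  shows "Ck_on k S f \<Longrightarrow> Ck_on k S (\<lambda>x. h (f x))"
proof (induction k arbitrary: f)
  case 0
  then show ?case by (simp add: bounded_linear.continuous_on[OF h])
next
  case (Suc k)
  have "Ck_on k S (\<lambda>x. frechet_derivative (\<lambda>x. h (f x)) (at x) v)" for v
  proof (rule Ck_on_cong[OF S])
    show "Ck_on k S (\<lambda>x. h (frechet_derivative f (at x) v))"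
      using Suc by simp
    show "h (frechet_derivative f (at x) v) = frechet_derivative (\<lambda>x. h (f x)) (at x) v" if "x \<in> S" for x
      by (rule frechet_derivative_bounded_linear[OF h, symmetric]) (use Suc.prems that in auto)
  qed
  then show ?case
    using Suc.prems by (auto intro!: differentiable_bounded_linear[OF h])
qed

lemma Ck_on_add:
  assumes S: "open S"
  shows "Ck_on k S f \<Longrightarrow> Ck_on k S g \<Longrightarrow> Ck_on k S (\<lambda>x. f x + g x)"
proof (induction k arbitrary: f g)
  case 0
  then show ?case by (simp add: continuous_on_add)
next
  case (Suc k)
  have "Ck_on k S (\<lambda>x. frechet_derivative (\<lambda>x. f x + g x) (at x) v)" for v
  proof (rule Ck_on_cong[OF S])
    show "Ck_on k S (\<lambda>x. frechet_derivative f (at x) v + frechet_derivative g (at x) v)"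
      using Suc by simp
    show "frechet_derivative f (at x) v + frechet_derivative g (at x) v
        = frechet_derivative (\<lambda>x. f x + g x) (at x) v" if "x \<in> S" for x
      using frechet_derivative_eqI[OF has_derivative_add[OF has_derivative_frechet has_derivative_frechet], of f x g]
        Suc.prems that by simp
  qed
  then show ?case using Suc.prems by (auto intro!: differentiable_add)
qed

text \<open>The product rule for factors in separate variables. A general \<open>h\<close> covers
  products of numbers as well as scalar multiples of vectors.\<close>

lemma has_derivative_prod_bilinear:
  assumes h: "bounded_bilinear h"
    and "(f has_derivative f') (at (fst z))" "(g has_derivative g') (at (snd z))"
  shows "((\<lambda>z. h (f (fst z)) (g (snd z))) has_derivative
    (\<lambda>v. h (f (fst z)) (g' (snd v)) + h (f' (fst v)) (g (snd z)))) (at z)"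
  by (intro bounded_bilinear.FDERIV[OF h] has_derivative_compose[of fst fst z UNIV f]
      has_derivative_compose[of snd snd z UNIV g] bounded_linear_imp_has_derivative
      bounded_linear_fst bounded_linear_snd assms)

text \<open>By the product rule each directional derivative is a sum of two products of the same
  shape, with one factor differentiated, so the induction runs over all \<open>f\<close> and
  \<open>g\<close>. The other factor is lowered from order \<open>Suc k\<close> to
  \<open>k\<close>.\<close>

lemma Ck_on_prod_bilinear:
  assumes h: "bounded_bilinear h" and S: "open S" and T: "open T"
  shows "Ck_on k S f \<Longrightarrow> Ck_on k T g \<Longrightarrow> Ck_on k (S \<times> T) (\<lambda>z. h (f (fst z)) (g (snd z)))"
proof (induction k arbitrary: f g)
  case 0
  then have "continuous_on (S \<times> T) (\<lambda>z. f (fst z))" "continuous_on (S \<times> T) (\<lambda>z. g (snd z))"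
    by (auto intro!: continuous_on_compose2[of S f] continuous_on_compose2[of T g] continuous_intros)
  then show ?case by (simp add: bounded_bilinear.continuous_on[OF h])
next
  case (Suc k)
  let ?D = "\<lambda>z v. h (f (fst z)) (frechet_derivative g (at (snd z)) (snd v))
     + h (frechet_derivative f (at (fst z)) (fst v)) (g (snd z))"
  have der: "((\<lambda>z. h (f (fst z)) (g (snd z))) has_derivative ?D z) (at z)" if "z \<in> S \<times> T" for z
    using Suc.prems that by (intro has_derivative_prod_bilinear[OF h] has_derivative_frechet) auto
  have "Ck_on k (S \<times> T) (\<lambda>z. frechet_derivative (\<lambda>z. h (f (fst z)) (g (snd z))) (at z) v)" for v
  proof (rule Ck_on_cong[of _ "\<lambda>z. ?D z v"])
    show "open (S \<times> T)" using S T by (rule open_Times)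
    show "Ck_on k (S \<times> T) (\<lambda>z. ?D z v)"
      using Suc.prems Ck_on_mono_Suc[OF Suc.prems(1)] Ck_on_mono_Suc[OF Suc.prems(2)]
      by (intro Ck_on_add open_Times S T Suc.IH[of f "\<lambda>y. frechet_derivative g (at y) (snd v)"]
          Suc.IH[of "\<lambda>x. frechet_derivative f (at x) (fst v)" g]) auto
    show "?D z v = frechet_derivative (\<lambda>z. h (f (fst z)) (g (snd z))) (at z) v" if "z \<in> S \<times> T" for z
      using frechet_derivative_eqI[OF der[OF that]] by simp
  qed
  moreover have "(\<lambda>z. h (f (fst z)) (g (snd z))) differentiable (at z)" if "z \<in> S \<times> T" for z
    using der[OF that] by (rule differentiableI)
  ultimately show ?case by simp
qed

section \<open>Symmetry of second derivatives\<close>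

text \<open>The second difference quotient of \<open>h\<close> is a value of the mixed derivative, by the mean value
  theorem applied in each direction; it is symmetric in the two directions.\<close>

lemma second_difference_mean_value:
  fixes h :: "'a::real_normed_vector \<Rightarrow> real"
  assumes h: "Ck_on 2 S h" and S: "ball x r \<subseteq> S" and t: "0 < t" "t * (norm u + norm v) < r"
  obtains y where "dist x y < r"
    "h (x + t *\<^sub>R u + t *\<^sub>R v) - h (x + t *\<^sub>R u) - h (x + t *\<^sub>R v) + h x =
      t\<^sup>2 * frechet_derivative (\<lambda>y. frechet_derivative h (at y) u) (at y) v"
proof -
  define D where "D y = frechet_derivative h (at y) u" for y
  have in_S: "dist x (x + a *\<^sub>R u + b *\<^sub>R v) < r" "x + a *\<^sub>R u + b *\<^sub>R v \<in> S"
    if "0 \<le> a" "a \<le> t" "0 \<le> b" "b \<le> t" for a b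
  proof -
    have "norm (a *\<^sub>R u + b *\<^sub>R v) \<le> a * norm u + b * norm v"
      using norm_triangle_ineq[of "a *\<^sub>R u" "b *\<^sub>R v"] that by simp
    also have "\<dots> \<le> t * norm u + t * norm v"
      using that by (intro add_mono mult_right_mono) auto
    finally have "norm (a *\<^sub>R u + b *\<^sub>R v) < r" using t by (simp add: algebra_simps)
    then show "dist x (x + a *\<^sub>R u + b *\<^sub>R v) < r"
      using norm_minus_cancel[of "a *\<^sub>R u + b *\<^sub>R v"] by (simp add: dist_norm add.assoc norm_minus_commute)
    then show "x + a *\<^sub>R u + b *\<^sub>R v \<in> S" using S by (auto simp: mem_ball)
  qed
  have dh: "h differentiable (at y)" and dD: "D differentiable (at y)" if "y \<in> S" for y
    using h that by (auto simp: numeral_2_eq_2 D_def[abs_def])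
  \<comment> \<open>Directional derivatives become derivatives in one real variable, the form that
    the mean value theorem takes.\<close>
  have line: "((\<lambda>s. f (c + s *\<^sub>R w)) has_real_derivative frechet_derivative f (at (c + s *\<^sub>R w)) w) (at s)"
    if "f differentiable (at (c + s *\<^sub>R w))" for f :: "'a \<Rightarrow> real" and c w s
  proof -
    have "((\<lambda>s. f (c + s *\<^sub>R w)) has_derivative
        (\<lambda>k. frechet_derivative f (at (c + s *\<^sub>R w)) (k *\<^sub>R w))) (at s)"
      by (rule has_derivative_compose[of "\<lambda>s. c + s *\<^sub>R w"])
         (use that in \<open>auto intro!: derivative_eq_intros has_derivative_frechet\<close>)
    then show ?thesis
      using linear_frechet_derivative[OF that]
      by (simp add: has_field_derivative_def linear_scale mult.commute[of _ "frechet_derivative f _ w"] fun_eq_iff)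
  qed
  \<comment> \<open>First application: to the difference of \<open>h\<close> along two parallel
    segments in direction \<open>u\<close>, displaced by \<open>t\<close> times \<open>v\<close>.
    The terms with \<open>0\<close> match the left endpoint in \<open>MVT2\<close>.\<close>
  have "\<exists>s>0. s < t \<and>
    (h (x + t *\<^sub>R u + t *\<^sub>R v) - h (x + t *\<^sub>R u)) - (h (x + 0 *\<^sub>R u + t *\<^sub>R v) - h (x + 0 *\<^sub>R u))
      = (t - 0) * (D (x + s *\<^sub>R u + t *\<^sub>R v) - D (x + s *\<^sub>R u))"
  proof (rule MVT2[OF t(1)])
    fix s assume s: "0 \<le> s" "s \<le> t"
    have "((\<lambda>s. h ((x + t *\<^sub>R v) + s *\<^sub>R u)) has_real_derivative D ((x + t *\<^sub>R v) + s *\<^sub>R u)) (at s)"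
      unfolding D_def using in_S(2)[of s t] s t by (intro line dh) (auto simp: algebra_simps)
    moreover have "((\<lambda>s. h (x + s *\<^sub>R u)) has_real_derivative D (x + s *\<^sub>R u)) (at s)"
      unfolding D_def using in_S(2)[of s 0] s t by (intro line dh) auto
    ultimately show "((\<lambda>s. h (x + s *\<^sub>R u + t *\<^sub>R v) - h (x + s *\<^sub>R u)) has_real_derivative
        (D (x + s *\<^sub>R u + t *\<^sub>R v) - D (x + s *\<^sub>R u))) (at s)"
      by (intro DERIV_diff) (simp_all add: algebra_simps)
  qed
  then obtain s where s: "0 < s" "s < t"
    "h (x + t *\<^sub>R u + t *\<^sub>R v) - h (x + t *\<^sub>R u) - h (x + t *\<^sub>R v) + h x
      = t * (D (x + s *\<^sub>R u + t *\<^sub>R v) - D (x + s *\<^sub>R u))"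
    by auto
  \<comment> \<open>Second application: to \<open>D\<close> in direction \<open>v\<close>, at the
    \<open>s\<close> just found.\<close>
  have "\<exists>a>0. a < t \<and> D (x + s *\<^sub>R u + t *\<^sub>R v) - D (x + s *\<^sub>R u + 0 *\<^sub>R v)
      = (t - 0) * frechet_derivative D (at (x + s *\<^sub>R u + a *\<^sub>R v)) v"
    using in_S(2)[of s] s by (intro MVT2[OF t(1)] line dD) auto
  then obtain a where a: "0 < a" "a < t" "D (x + s *\<^sub>R u + t *\<^sub>R v) - D (x + s *\<^sub>R u)
      = t * frechet_derivative D (at (x + s *\<^sub>R u + a *\<^sub>R v)) v"
    by auto
  show thesis
    using in_S(1)[of s a] s a
    by (intro that[of "x + s *\<^sub>R u + a *\<^sub>R v"]) (auto simp: power2_eq_square D_def[abs_def])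
qed

text \<open>Schwarz's theorem. For small \<open>t\<close> the second difference, symmetric in
  \<open>u\<close> and \<open>v\<close>, is t^2 times either mixed derivative at some point near
  \<open>x\<close>; continuity of both at \<open>x\<close> forces their values there to
  agree.\<close>

lemma second_derivative_symmetric_real:
  fixes h :: "'a::real_normed_vector \<Rightarrow> real"
  assumes h: "Ck_on 2 S h" and S: "open S" and x: "x \<in> S"
  shows "frechet_derivative (\<lambda>y. frechet_derivative h (at y) u) (at x) v =
         frechet_derivative (\<lambda>y. frechet_derivative h (at y) v) (at x) u"
proof -
  define D where "D u v y = frechet_derivative (\<lambda>y. frechet_derivative h (at y) u) (at y) v" for u v y
  have cont: "isCont (D u v) x" for u v
    using h S x by (auto simp: numeral_2_eq_2 D_def[abs_def] continuous_on_eq_continuous_at)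
  have "\<bar>D u v x - D v u x\<bar> < e" if e: "e > 0" for e
  proof -
    obtain r1 where r1: "r1 > 0" "\<And>y. dist x y < r1 \<Longrightarrow> dist (D u v y) (D u v x) < e / 2"
      using cont[of u v] e unfolding continuous_at_eps_delta by (metis dist_commute half_gt_zero)
    obtain r2 where r2: "r2 > 0" "\<And>y. dist x y < r2 \<Longrightarrow> dist (D v u y) (D v u x) < e / 2"
      using cont[of v u] e unfolding continuous_at_eps_delta by (metis dist_commute half_gt_zero)
    obtain r3 where r3: "r3 > 0" "ball x r3 \<subseteq> S" using S x openE by blast
    define r where "r = min r1 (min r2 r3)"
    have r: "r > 0" "ball x r \<subseteq> S" using r1 r2 r3 by (auto simp: r_def)
    \<comment> \<open>The summand 1 keeps the denominator positive when \<open>u\<close> and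
      \<open>v\<close> vanish and makes the bound on \<open>t * (norm u + norm v)\<close>
      strict.\<close>
    define t where "t = r / (norm u + norm v + 1)"
    have n: "norm u + norm v + 1 > 0" by (smt (verit) norm_ge_zero)
    have t: "t > 0" "t * (norm u + norm v) < r" "t * (norm v + norm u) < r"
      using r n by (auto simp: t_def field_simps add_pos_pos)
    obtain y where y: "dist x y < r"
      "h (x + t *\<^sub>R u + t *\<^sub>R v) - h (x + t *\<^sub>R u) - h (x + t *\<^sub>R v) + h x = t\<^sup>2 * D u v y"
      using second_difference_mean_value[OF h r(2) t(1,2)] unfolding D_def by blast
    obtain z where z: "dist x z < r"
      "h (x + t *\<^sub>R v + t *\<^sub>R u) - h (x + t *\<^sub>R v) - h (x + t *\<^sub>R u) + h x = t\<^sup>2 * D v u z"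
      using second_difference_mean_value[OF h r(2) t(1,3)] unfolding D_def by blast
    have "t\<^sup>2 * D u v y = t\<^sup>2 * D v u z"
      using y(2) z(2) by (simp add: algebra_simps)
    then have "D u v y = D v u z" using t by simp
    moreover have "dist (D u v y) (D u v x) < e / 2" "dist (D v u z) (D v u x) < e / 2"
      using r1 r2 y z by (auto simp: r_def)
    ultimately show ?thesis unfolding dist_real_def by linarith
  qed
  then have "D u v x = D v u x" by (metis abs_0 abs_eq_0 less_irrefl eq_iff_diff_eq_0 zero_less_abs_iff)
  then show ?thesis by (simp add: D_def)
qed

text \<open>The real case is applied to each coordinate; taking a coordinate is linear and commutes
  with both derivatives.\<close>

lemma second_derivative_symmetric:
  fixes h :: "'a::real_normed_vector \<Rightarrow> 'b::euclidean_space"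
  assumes h: "Ck_on 2 S h" and S: "open S" and x: "x \<in> S"
  shows "frechet_derivative (\<lambda>y. frechet_derivative h (at y) u) (at x) v =
         frechet_derivative (\<lambda>y. frechet_derivative h (at y) v) (at x) u"
proof (rule euclidean_eqI)
  fix b :: 'b assume "b \<in> Basis"
  have d1: "h differentiable (at y)" if "y \<in> S" for y
    using h that by (auto simp: numeral_2_eq_2)
  have d2: "(\<lambda>y. frechet_derivative h (at y) u) differentiable (at y)" if "y \<in> S" for y u
    using h that by (auto simp: numeral_2_eq_2)
  note inner_b = bounded_linear_inner_left[of b]
  have inner: "frechet_derivative (\<lambda>y. frechet_derivative (\<lambda>y. h y \<bullet> b) (at y) u) (at x) v =
    frechet_derivative (\<lambda>y. frechet_derivative h (at y) u) (at x) v \<bullet> b" for u v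
  proof -
    have "frechet_derivative (\<lambda>y. frechet_derivative h (at y) u \<bullet> b) (at x) =
        frechet_derivative (\<lambda>y. frechet_derivative (\<lambda>y. h y \<bullet> b) (at y) u) (at x)"
      by (rule frechet_derivative_cong[OF S x])
         (use frechet_derivative_bounded_linear[OF inner_b d1]
           differentiable_bounded_linear[OF inner_b d2[OF x]] in auto)
    from fun_cong[OF this, of v] show ?thesis
      using frechet_derivative_bounded_linear[OF inner_b d2[OF x, of u], of v] by simp
  qed
  show "frechet_derivative (\<lambda>y. frechet_derivative h (at y) u) (at x) v \<bullet> b =
         frechet_derivative (\<lambda>y. frechet_derivative h (at y) v) (at x) u \<bullet> b"
    using second_derivative_symmetric_real[OF Ck_on_bounded_linear[OF bounded_linear_inner_left S h, of b] S x, of u v]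
    by (simp add: inner)
qed

section \<open>Linear algebra: families of linear maps, linear systems and traces\<close>

lemma linear_expand:
  fixes L :: "'e::euclidean_space \<Rightarrow> 'z::real_vector"
  assumes "linear L"
  shows "L w = (\<Sum>b\<in>Basis. (w \<bullet> b) *\<^sub>R L b)"
  using linear_sum[OF assms, of "\<lambda>b. (w \<bullet> b) *\<^sub>R b" Basis] linear_scale[OF assms]
  by (simp add: euclidean_representation)

lemma linear_functional_inner:
  fixes l :: "'e::euclidean_space \<Rightarrow> real"
  assumes "linear l"
  shows "(\<Sum>b\<in>Basis. l b *\<^sub>R b) \<bullet> w = l w"
  using linear_expand[OF assms, of w] by (simp add: inner_sum_left inner_commute[of w] mult.commute)

text \<open>Differentiability of \<open>L\<close> is given on each fixed vector. Expanding
  \<open>P y\<close> in the finite basis reduces the claim to finitely many ordinary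
  products.\<close>

lemma has_derivative_linear_family:
  fixes L :: "'a::real_normed_vector \<Rightarrow> 'e::euclidean_space \<Rightarrow> 'z::real_normed_vector"
  assumes U: "open U" "x \<in> U"
    and lin: "\<And>y. y \<in> U \<Longrightarrow> linear (L y)"
    and L: "\<And>v. ((\<lambda>y. L y v) has_derivative L' v) (at x)"
    and P: "(P has_derivative P') (at x)"
  shows "((\<lambda>y. L y (P y)) has_derivative (\<lambda>h. L' (P x) h + L x (P' h))) (at x)"
proof -
  note expand = linear_expand[OF lin]
  have der: "((\<lambda>y. L y (P y)) has_derivative
      (\<lambda>h. \<Sum>b\<in>Basis. (P x \<bullet> b) *\<^sub>R L' b h + (P' h \<bullet> b) *\<^sub>R L x b)) (at x)"
    if "(P has_derivative P') (at x)" for P P'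
  proof (rule has_derivative_transform_within_open[OF _ U])
    show "((\<lambda>y. \<Sum>b\<in>Basis. (P y \<bullet> b) *\<^sub>R L y b) has_derivative
      (\<lambda>h. \<Sum>b\<in>Basis. (P x \<bullet> b) *\<^sub>R L' b h + (P' h \<bullet> b) *\<^sub>R L x b)) (at x)"
      using that L by (intro has_derivative_sum has_derivative_scaleR has_derivative_inner_left)
  qed (simp add: expand[symmetric])
  \<comment> \<open>Linearity of \<open>L'\<close> in its vector argument is obtained here: the
    formula for constant \<open>P\<close> is compared with the hypothesis by uniqueness of the
    derivative.\<close>
  have "L' (P x) = (\<lambda>h. \<Sum>b\<in>Basis. (P x \<bullet> b) *\<^sub>R L' b h)"
    using has_derivative_unique[OF L[of "P x"] der[of "\<lambda>_. P x", OF has_derivative_const]] by simp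
  then have "L' (P x) h + L x (P' h) = (\<Sum>b\<in>Basis. (P x \<bullet> b) *\<^sub>R L' b h + (P' h \<bullet> b) *\<^sub>R L x b)" for h
    using expand[OF U(2), of "P' h"] by (simp add: sum.distrib)
  then show ?thesis using der[OF P] by simp
qed

text \<open>With \<open>C\<close> the inverse of the system at \<open>x\<close>, the increment \<open>W\<close> of \<open>X\<close> solves \<open>W = Z - K W\<close>, where
  \<open>Z\<close> is differentiable and \<open>K\<close> tends to \<open>0\<close>; hence \<open>W\<close> and \<open>Z\<close> agree to first order.\<close>

lemma differentiable_solution_of_positive_system:
  fixes G :: "'a::real_normed_vector \<Rightarrow> 'e::euclidean_space \<Rightarrow> 'e \<Rightarrow> real"
  assumes U: "open U" "x \<in> U"
    and bil: "\<And>y. y \<in> U \<Longrightarrow> bilinear (G y)"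
    and pos: "\<And>v. v \<noteq> 0 \<Longrightarrow> 0 < G x v v"
    and dG: "\<And>v w. (\<lambda>y. G y v w) differentiable (at x)"
    and dX: "\<And>w. (\<lambda>y. G y (X y) w) differentiable (at x)"
  shows "X differentiable (at x)"
proof -
  \<comment> \<open>\<open>A y\<close> is the Gram operator of \<open>G y\<close>: the inner product
    of \<open>A y v\<close> with \<open>w\<close> is \<open>G y v w\<close>. Positivity at
    \<open>x\<close> makes \<open>A x\<close> injective, which supplies the left inverse
    \<open>C\<close>.\<close>
  define A where "A y v = (\<Sum>b\<in>Basis. G y v b *\<^sub>R b)" for y v
  have A_linear: "linear (A y)" if "y \<in> U" for y
    using bil[OF that] unfolding bilinear_def A_def
    by (auto simp: linear_iff scaleR_add_left sum.distrib scaleR_sum_right)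
  have A_inner: "A x v \<bullet> v = G x v v" for v
    using bil[OF U(2)] unfolding A_def bilinear_def by (intro linear_functional_inner) auto
  have "inj (A x)"
    unfolding linear_injective_0[OF A_linear[OF U(2)]] using A_inner pos by (metis inner_zero_left less_irrefl)
  then obtain C where C: "linear C" "C \<circ> A x = id"
    using linear_injective_left_inverse[OF A_linear[OF U(2)]] by blast
  have CA: "C (A x v) = v" for v using C(2) by (metis comp_apply id_apply)
  have C_bl: "bounded_linear C" using C(1) linear_conv_bounded_linear by blast
  \<comment> \<open>\<open>K y\<close> is the error of \<open>C\<close> as a left inverse of
    \<open>A y\<close>. It vanishes at \<open>x\<close>, and for \<open>y\<close> in
    \<open>U\<close> its operator norm is at most \<open>eps y\<close>.\<close>
  define K where "K y v = C (A y v) - v" for y v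
  have K_linear: "linear (K y)" if "y \<in> U" for y
    unfolding K_def using A_linear[OF that] C(1) by (simp add: linear_iff algebra_simps)
  have dA: "(\<lambda>y. A y v) differentiable (at x)" "(\<lambda>y. A y (X y)) differentiable (at x)" for v
    unfolding A_def using dG dX by (auto intro!: differentiable_sum differentiable_scaleR)
  have dK: "(\<lambda>y. K y v) differentiable (at x)" for v
    unfolding K_def using dA by (intro differentiable_diff differentiable_bounded_linear[OF C_bl]) auto
  define eps where "eps y = (\<Sum>b\<in>Basis. norm (K y b))" for y
  have K_eps: "norm (K y w) \<le> eps y * norm w" if "y \<in> U" for y w
  proof -
    have "K y w = (\<Sum>b\<in>Basis. (w \<bullet> b) *\<^sub>R K y b)"
      by (rule linear_expand[OF K_linear[OF that]])
    also have "norm \<dots> \<le> (\<Sum>b\<in>Basis. norm (K y b) * norm w)"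
      by (rule sum_norm_le) (simp add: mult.commute[of "norm (K y _)"] mult_right_mono Basis_le_norm)
    finally show ?thesis by (simp add: eps_def sum_distrib_right)
  qed
  have "isCont eps x"
    unfolding eps_def using dK by (intro continuous_intros differentiable_imp_continuous_within) auto
  moreover have "eps x = 0" by (simp add: eps_def K_def CA)
  moreover have eps_pos: "eps y \<ge> 0" for y by (simp add: eps_def sum_nonneg)
  ultimately have eps_small: "\<exists>d>0. \<forall>y. norm (y - x) < d \<longrightarrow> eps y < e" if "e > 0" for e
    using that unfolding continuous_at_eps_delta dist_norm by (auto dest!: spec[of _ e])
  \<comment> \<open>Here \<open>X\<close> enters only through \<open>A y (X y)\<close>, whose
    coordinates are differentiable by hypothesis, and through the fixed vector
    \<open>X x\<close>.\<close>
  define Z where "Z y = C (A y (X y)) - K y (X x) - X x" for y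
  have "Z differentiable (at x)"
    unfolding Z_def using dA dK
    by (intro differentiable_diff differentiable_bounded_linear[OF C_bl]) auto
  then obtain Z' where Z': "(Z has_derivative Z') (at x)" by (auto simp: differentiable_def)
  have Z0: "Z x = 0" by (simp add: Z_def K_def CA)
  obtain B where B: "B > 0" "\<And>h. norm (Z' h) \<le> norm h * B"
    using bounded_linear.pos_bounded[OF has_derivative_bounded_linear[OF Z']] by blast
  have fixpoint: "X y - X x = Z y - K y (X y - X x)" if "y \<in> U" for y
    using linear_diff[OF K_linear[OF that], of "X y" "X x"] by (simp add: Z_def K_def)
  have "(X has_derivative Z') (at x)"
    unfolding has_derivative_at_alt
  proof (intro conjI allI impI)
    show "bounded_linear Z'" using Z' by (rule has_derivative_bounded_linear)
    fix e :: real assume e: "e > 0"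
    \<comment> \<open>The bounds fit together as follows: \<open>1\<close> makes the norm of
      \<open>Z y\<close> at most (B + 1) |h|; \<open>1/2\<close> absorbs \<open>K y W\<close> and
      makes that of \<open>W\<close> at most 2 (B + 1) |h|; then \<open>e / 2\<close> and
      \<open>e / (4 * (B + 1))\<close> each contribute (e / 2) |h|.\<close>
    obtain d1 where d1: "d1 > 0" "\<And>y. norm (y - x) < d1 \<Longrightarrow>
        norm (Z y - Z x - Z' (y - x)) \<le> min 1 (e / 2) * norm (y - x)"
      using Z' e unfolding has_derivative_at_alt by (metis half_gt_zero min_less_iff_conj zero_less_one)
    obtain d2 where d2: "d2 > 0" "\<And>y. norm (y - x) < d2 \<Longrightarrow> eps y < min (1/2) (e / (4 * (B + 1)))"
      using eps_small[of "min (1/2) (e / (4 * (B + 1)))"] e B by auto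
    obtain d3 where d3: "d3 > 0" "ball x d3 \<subseteq> U" using U openE by blast
    have "norm (X y - X x - Z' (y - x)) \<le> e * norm (y - x)"
      if y: "norm (y - x) < min d1 (min d2 d3)" for y
    proof -
      have yU: "y \<in> U" using d3 y by (auto simp: dist_norm norm_minus_commute)
      define h W where "h = y - x" and "W = X y - X x"
      have W: "W = Z y - K y W" using fixpoint[OF yU] by (simp add: W_def)
      have Zh: "norm (Z y - Z' h) \<le> min 1 (e / 2) * norm h"
        using d1(2)[of y] y by (simp add: h_def Z0)
      then have Zh1: "norm (Z y - Z' h) \<le> 1 * norm h" and Zh2: "norm (Z y - Z' h) \<le> e / 2 * norm h"
        by (meson min.cobounded1 min.cobounded2 mult_right_mono norm_ge_zero order_trans)+
      have Zb: "norm (Z y) \<le> (B + 1) * norm h"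
        using norm_triangle_ineq[of "Z y - Z' h" "Z' h"] Zh1 B(2)[of h] by (simp add: algebra_simps)
      have KW: "norm (K y W) \<le> eps y * norm W" by (rule K_eps[OF yU])
      also have "\<dots> \<le> 1/2 * norm W"
        using d2(2)[of y] y by (intro mult_right_mono) auto
      finally have "norm W \<le> 2 * norm (Z y)"
        using norm_triangle_ineq4[of "Z y" "K y W"] W by simp
      then have Wb: "norm W \<le> 2 * ((B + 1) * norm h)" using Zb by linarith
      have "eps y * norm W \<le> e / (4 * (B + 1)) * (2 * ((B + 1) * norm h))"
        using d2(2)[of y] y e B by (intro mult_mono Wb) auto
      then have "norm (K y W) \<le> e / (4 * (B + 1)) * (2 * ((B + 1) * norm h))"
        using KW by (rule order_trans[rotated])
      also have "\<dots> = e / 2 * norm h" using B by (simp add: divide_simps)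
      finally have "norm (K y W) \<le> e / 2 * norm h" .
      moreover have eq: "W - Z' h = (Z y - Z' h) - K y W" using W by (simp add: algebra_simps)
      have "norm (W - Z' h) \<le> norm (Z y - Z' h) + norm (K y W)"
        unfolding eq by (rule norm_triangle_ineq4)
      ultimately have "norm (W - Z' h) \<le> e * norm h" using Zh2 by linarith
      then show ?thesis by (simp add: W_def h_def)
    qed
    then show "\<exists>d>0. \<forall>y. norm (y - x) < d \<longrightarrow> norm (X y - X x - Z' (y - x)) \<le> e * norm (y - x)"
      using d1(1) d2(1) d3(1) by (intro exI[of _ "min d1 (min d2 d3)"]) auto
  qed
  then show ?thesis by (rule differentiableI)
qed

text \<open>Both sides are the same double sum of products of matrix entries. This makes the trace
  invariant under conjugation by a Jacobian.\<close>

lemma lin_trace_compose_commute: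
  fixes A :: "'e::euclidean_space \<Rightarrow> 'f::euclidean_space" and B :: "'f \<Rightarrow> 'e"
  assumes "linear A" "linear B"
  shows "lin_trace (A \<circ> B) = lin_trace (B \<circ> A)"
proof -
  have expand: "L w \<bullet> c = (\<Sum>b\<in>Basis. (w \<bullet> b) * (L b \<bullet> c))"
    if "linear L" for L :: "'x::euclidean_space \<Rightarrow> 'y::euclidean_space" and w c
    by (subst linear_expand[OF that]) (simp add: inner_sum_left)
  show ?thesis
    unfolding lin_trace_def comp_def expand[OF assms(1), of "B _"] expand[OF assms(2), of "A _"]
    by (subst sum.swap) (simp add: mult.commute)
qed

lemma lin_trace_add: "lin_trace (\<lambda>u. A u + B u) = lin_trace A + lin_trace B"
  by (simp add: lin_trace_def inner_add_left sum.distrib)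

lemma lin_trace_scale: "lin_trace (\<lambda>u. c *\<^sub>R A u) = c * lin_trace A"
  by (simp add: lin_trace_def sum_distrib_left)

text \<open>The basis of the product consists of the vectors \<open>(b, 0)\<close> and
  \<open>(0, b)\<close>, so only the diagonal blocks count.\<close>

lemma lin_trace_Pair:
  fixes A :: "'e::euclidean_space \<Rightarrow> 'f::euclidean_space \<Rightarrow> 'e" and B :: "'e \<Rightarrow> 'f \<Rightarrow> 'f"
  shows "lin_trace (\<lambda>u. (A (fst u) (snd u), B (fst u) (snd u))) =
    lin_trace (\<lambda>u. A u 0) + lin_trace (\<lambda>u. B 0 u)"
proof -
  have "A (fst b) (snd b) \<bullet> fst b + B (fst b) (snd b) \<bullet> snd b =
      (A (fst b) (snd b), B (fst b) (snd b)) \<bullet> b" for b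
    by (simp add: inner_prod_def)
  moreover have "(\<Sum>b\<in>Basis. f b) = (\<Sum>b\<in>Basis. f (b, 0)) + (\<Sum>b\<in>Basis. f (0, b))"
    for f :: "'e \<times> 'f \<Rightarrow> real"
    unfolding Basis_prod_def
    by (subst sum.union_disjoint) (auto simp: sum.reindex inj_on_def)
  ultimately show ?thesis by (simp add: lin_trace_def inner_prod_def)
qed


section \<open>The Laplacian in a chart\<close>

abbreviation differential ::
  "('a, 'i, 'e::euclidean_space) riem_mfd \<Rightarrow> ('a \<Rightarrow> real) \<Rightarrow> 'i \<Rightarrow> 'a \<Rightarrow> 'e \<Rightarrow> real" where
  "differential M f i p \<equiv> frechet_derivative (f \<circ> chart_inv M i) (at (chart_map M i p))"

text \<open>The chart is an argument here, whereas \<open>divergence\<close> uses the one picked by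
  \<open>chart_at\<close>; values in different charts can thus be compared.\<close>

definition laplacian :: "('a, 'i, 'e::euclidean_space) riem_mfd \<Rightarrow> 'i \<Rightarrow> ('a \<Rightarrow> real) \<Rightarrow> 'a \<Rightarrow> real" where
  "laplacian M i f p = lin_trace (levi_civita M (grad M f) i p)"

section \<open>Gradient, metric derivatives and Christoffel symbols in a fixed chart\<close>

context riemannian_manifold
begin

lemma chart_inv_in_dom: "x \<in> chart_img M i \<Longrightarrow> chart_inv M i x \<in> chart_dom M i"
  by (simp add: chart_img_def chart_inv_def inv_into_into)

lemma chart_chart_inv: "x \<in> chart_img M i \<Longrightarrow> chart_map M i (chart_inv M i x) = x"
  by (simp add: chart_img_def chart_inv_def f_inv_into_f)

lemma chart_in_img: "p \<in> chart_dom M i \<Longrightarrow> chart_map M i p \<in> chart_img M i"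
  by (simp add: chart_img_def)

lemma metric_linear_left: "i \<in> chart_idx M \<Longrightarrow> p \<in> chart_dom M i \<Longrightarrow> linear (\<lambda>v. riem_metric M i p v w)"
  and metric_linear_right: "i \<in> chart_idx M \<Longrightarrow> p \<in> chart_dom M i \<Longrightarrow> linear (riem_metric M i p v)"
  using metric_bilinear by (auto simp: bilinear_def)

lemma metric_eqI:
  assumes "i \<in> chart_idx M" "p \<in> chart_dom M i" "\<And>w. riem_metric M i p v w = riem_metric M i p v' w"
  shows "v = v'"
proof (rule ccontr)
  assume "v \<noteq> v'"
  then have "0 < riem_metric M i p (v - v') (v - v')" using metric_pos assms by simp
  moreover have "riem_metric M i p (v - v') (v - v') = 0"
    using linear_diff[OF metric_linear_left[OF assms(1,2)]] assms(3) by simp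
  ultimately show False by simp
qed

text \<open>Riesz representation for the metric: positivity makes \<open>A\<close> injective, finite
  dimension makes it surjective. This justifies the definite descriptions in \<open>grad\<close> and
  \<open>christoffel\<close>.\<close>

lemma metric_represents:
  assumes i: "i \<in> chart_idx M" "p \<in> chart_dom M i" and l: "linear l"
  shows "\<exists>!v. \<forall>w. riem_metric M i p v w = l w"
proof -
  define A where "A v = (\<Sum>b\<in>Basis. riem_metric M i p v b *\<^sub>R b)" for v
  have inner_A: "A v \<bullet> w = riem_metric M i p v w" for v w
    unfolding A_def by (rule linear_functional_inner[OF metric_linear_right[OF i]])
  have A: "linear A"
    by (rule linearI; rule euclidean_eqI)
       (simp_all add: inner_A inner_add_left linear_add[OF metric_linear_left[OF i]]
         linear_scale[OF metric_linear_left[OF i]])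
  have "inj A"
    using metric_pos[OF i] inner_A unfolding linear_injective_0[OF A] by (metis inner_zero_left less_irrefl)
  then have "surj A" using A linear_injective_imp_surjective by blast
  then obtain v where v: "A v = (\<Sum>b\<in>Basis. l b *\<^sub>R b)" by (metis surj_def)
  have "A v \<bullet> w = l w" for w
    unfolding v by (rule linear_functional_inner[OF l])
  then have "\<forall>w. riem_metric M i p v w = l w" by (simp add: inner_A)
  then show ?thesis using metric_eqI[OF i] by metis
qed

lemma Ck_differentiable:
  "Ck_on_mfd (Suc k) M f \<Longrightarrow> i \<in> chart_idx M \<Longrightarrow> x \<in> chart_img M i \<Longrightarrow>
    (f \<circ> chart_inv M i) differentiable (at x)"
  by (simp add: Ck_on_mfd_def)

text \<open>Differentiability makes the differential linear, so the definite description in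
  \<open>grad\<close> denotes its representing vector.\<close>

lemma grad_works:
  assumes "i \<in> chart_idx M" "p \<in> chart_dom M i" "(f \<circ> chart_inv M i) differentiable (at (chart_map M i p))"
  shows "riem_metric M i p (grad M f i p) w = differential M f i p w"
  using theI'[OF metric_represents[OF assms(1,2) linear_frechet_derivative[OF assms(3)]]]
  by (simp add: grad_def)

lemma grad_eqI:
  assumes "i \<in> chart_idx M" "p \<in> chart_dom M i"
    "((f \<circ> chart_inv M i) has_derivative riem_metric M i p v) (at (chart_map M i p))"
  shows "grad M f i p = v"
  using assms grad_works[OF assms(1,2) differentiableI[OF assms(3)]] frechet_derivative_eqI[OF assms(3)]
  by (intro metric_eqI) auto

lemma grad_has_derivative:
  assumes "i \<in> chart_idx M" "p \<in> chart_dom M i" "(f \<circ> chart_inv M i) differentiable (at (chart_map M i p))"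
  shows "((f \<circ> chart_inv M i) has_derivative riem_metric M i p (grad M f i p)) (at (chart_map M i p))"
proof -
  have "riem_metric M i p (grad M f i p) = differential M f i p"
    using grad_works[OF assms] by blast
  then show ?thesis using has_derivative_frechet[OF assms(3)] by simp
qed

lemma metric_differentiable:
  "i \<in> chart_idx M \<Longrightarrow> x \<in> chart_img M i \<Longrightarrow>
    (\<lambda>x. riem_metric M i (chart_inv M i x) v w) differentiable (at x)"
  using metric_smooth[of i v w, unfolded smooth_on_def, THEN spec, of "Suc 0"] by simp

lemma metric_deriv_works:
  "i \<in> chart_idx M \<Longrightarrow> p \<in> chart_dom M i \<Longrightarrow>
    ((\<lambda>x. riem_metric M i (chart_inv M i x) v w) has_derivative (\<lambda>u. metric_deriv M i p u v w))
      (at (chart_map M i p))"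
  using has_derivative_frechet[OF metric_differentiable[OF _ chart_in_img]] by (simp add: metric_deriv_def)

text \<open>Formulas for \<open>chart_inv\<close> hold on the chart image only; agreement on an open
  neighbourhood still determines the derivative.\<close>

lemma metric_deriv_eqI:
  assumes i: "i \<in> chart_idx M" "p \<in> chart_dom M i"
    and S: "open S" "chart_map M i p \<in> S" "\<And>x. x \<in> S \<Longrightarrow> f x = riem_metric M i (chart_inv M i x) v w"
    and "(f has_derivative f') (at (chart_map M i p))"
  shows "metric_deriv M i p u v w = f' u"
  using fun_cong[OF has_derivative_unique[OF metric_deriv_works[OF i]
      has_derivative_transform_within_open[OF assms(6) S]]] .

lemma metric_deriv_sym:
  assumes i: "i \<in> chart_idx M" "p \<in> chart_dom M i"
  shows "metric_deriv M i p u v w = metric_deriv M i p u w v"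
  by (rule metric_deriv_eqI[OF i open_chart_img[OF i(1)] chart_in_img[OF i(2)] _ metric_deriv_works[OF i]])
     (rule metric_sym[OF i(1) chart_inv_in_dom])

text \<open>Linearity in \<open>u\<close> is that of a derivative; in \<open>w\<close> it comes from
  bilinearity of the metric at nearby points, and in \<open>v\<close> from symmetry.\<close>

lemma metric_deriv_linear:
  assumes i: "i \<in> chart_idx M" "p \<in> chart_dom M i"
  shows "linear (\<lambda>u. metric_deriv M i p u v w)" "linear (\<lambda>v. metric_deriv M i p u v w)"
    "linear (\<lambda>w. metric_deriv M i p u v w)"
proof -
  show "linear (\<lambda>u. metric_deriv M i p u v w)"
    using has_derivative_linear[OF metric_deriv_works[OF i]] .
  show lin: "linear (\<lambda>w. metric_deriv M i p u v w)" for v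
  proof (rule linearI)
    fix w w' c
    note eqI = metric_deriv_eqI[OF i open_chart_img[OF i(1)] chart_in_img[OF i(2)]]
    show "metric_deriv M i p u v (w + w') = metric_deriv M i p u v w + metric_deriv M i p u v w'"
      by (rule eqI[OF _ has_derivative_add[OF metric_deriv_works[OF i] metric_deriv_works[OF i]]])
         (simp add: linear_add[OF metric_linear_right[OF i(1) chart_inv_in_dom]])
    show "metric_deriv M i p u v (c *\<^sub>R w) = c *\<^sub>R metric_deriv M i p u v w"
      by (rule eqI[OF _ has_derivative_scaleR_right[OF metric_deriv_works[OF i]]])
         (simp add: linear_scale[OF metric_linear_right[OF i(1) chart_inv_in_dom]])
  qed
  show "linear (\<lambda>v. metric_deriv M i p u v w)"
    using lin[of w] by (simp add: metric_deriv_sym[OF i, of u w])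
qed

text \<open>The Koszul expression is linear in \<open>w\<close>, hence represented by a
  vector.\<close>

lemma christoffel_works:
  assumes i: "i \<in> chart_idx M" "p \<in> chart_dom M i"
  shows "riem_metric M i p (christoffel M i p u v) w =
     (metric_deriv M i p u v w + metric_deriv M i p v u w - metric_deriv M i p w u v) / 2"
proof -
  have "linear (\<lambda>w. (metric_deriv M i p u v w + metric_deriv M i p v u w - metric_deriv M i p w u v) / 2)"
    using metric_deriv_linear[OF i] by (simp add: linear_iff field_simps)
  from theI'[OF metric_represents[OF i this]] show ?thesis by (simp add: christoffel_def)
qed

lemma christoffel_eqI:
  assumes i: "i \<in> chart_idx M" "p \<in> chart_dom M i"
    and "\<And>w. riem_metric M i p z w =
     (metric_deriv M i p u v w + metric_deriv M i p v u w - metric_deriv M i p w u v) / 2"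
  shows "christoffel M i p u v = z"
  by (rule metric_eqI[OF i]) (simp add: christoffel_works[OF i] assms(3))

lemma christoffel_linear:
  assumes i: "i \<in> chart_idx M" "p \<in> chart_dom M i"
  shows "linear (\<lambda>u. christoffel M i p u v)" "linear (\<lambda>v. christoffel M i p u v)"
proof -
  note add = linear_add[OF metric_linear_left[OF i]] metric_deriv_linear[OF i, THEN linear_add]
  note scale = linear_scale[OF metric_linear_left[OF i]] metric_deriv_linear[OF i, THEN linear_scale]
  show "linear (\<lambda>u. christoffel M i p u v)"
    by (intro linearI christoffel_eqI[OF i])
       (simp_all only: add scale christoffel_works[OF i] real_scaleR_def,
         simp_all add: algebra_simps add_divide_distrib diff_divide_distrib)
  show "linear (\<lambda>v. christoffel M i p u v)"
    by (intro linearI christoffel_eqI[OF i])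
       (simp_all only: add scale christoffel_works[OF i] real_scaleR_def,
         simp_all add: algebra_simps add_divide_distrib diff_divide_distrib)
qed

text \<open>The equations g(grad f, w) = df(w) form a positive definite linear system. Its
  coefficients are smooth and its right-hand sides differentiable because \<open>f\<close> is C^2,
  so its solution is differentiable.\<close>

lemma grad_differentiable:
  assumes i: "i \<in> chart_idx M" "x \<in> chart_img M i" and f: "Ck_on_mfd 2 M f"
  shows "(\<lambda>x. grad M f i (chart_inv M i x)) differentiable (at x)"
proof (rule differentiable_solution_of_positive_system[OF open_chart_img[OF i(1)] i(2)])
  show "bilinear (riem_metric M i (chart_inv M i y))" if "y \<in> chart_img M i" for y
    using metric_bilinear[OF i(1) chart_inv_in_dom[OF that]] .
  show "0 < riem_metric M i (chart_inv M i x) v v" if "v \<noteq> 0" for v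
    using metric_pos[OF i(1) chart_inv_in_dom[OF i(2)] that] .
  show "(\<lambda>y. riem_metric M i (chart_inv M i y) v w) differentiable (at x)" for v w
    using metric_differentiable[OF i] .
  have "(\<lambda>y. frechet_derivative (f \<circ> chart_inv M i) (at y) w) differentiable (at x)" for w
    using f i by (simp add: Ck_on_mfd_def numeral_2_eq_2)
  then obtain D where "((\<lambda>y. frechet_derivative (f \<circ> chart_inv M i) (at y) w) has_derivative D w) (at x)" for w
    unfolding differentiable_def by metis
  then have "((\<lambda>y. riem_metric M i (chart_inv M i y) (grad M f i (chart_inv M i y)) w) has_derivative D w) (at x)" for w
    by (rule has_derivative_transform_within_open[OF _ open_chart_img[OF i(1)] i(2)])
       (use Ck_differentiable[OF f[unfolded numeral_2_eq_2] i(1)] in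
         \<open>simp add: grad_works[OF i(1) chart_inv_in_dom] chart_chart_inv\<close>)
  then show "(\<lambda>y. riem_metric M i (chart_inv M i y) (grad M f i (chart_inv M i y)) w) differentiable (at x)" for w
    by (rule differentiableI)
qed

lemma levi_civita_linear:
  assumes i: "i \<in> chart_idx M" "p \<in> chart_dom M i"
    and X: "(\<lambda>x. X i (chart_inv M i x)) differentiable (at (chart_map M i p))"
  shows "linear (levi_civita M X i p)"
  unfolding levi_civita_def
  by (intro linear_compose_add linear_frechet_derivative[OF X] christoffel_linear[OF i])

end

section \<open>Independence of the chart\<close>

text \<open>Later proofs instantiate this locale again with the two charts exchanged, or at another
  point of their overlap.\<close>

locale chart_change = riemannian_manifold M
  for M :: "('a, 'i, 'e::euclidean_space) riem_mfd" +
  fixes i j :: 'i and p :: 'a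
  assumes idx: "i \<in> chart_idx M" "j \<in> chart_idx M"
    and p: "p \<in> chart_dom M i" "p \<in> chart_dom M j"
begin

abbreviation "overlap \<equiv> chart_map M i ` (chart_dom M i \<inter> chart_dom M j)"

abbreviation "x0 \<equiv> chart_map M i p"

text \<open>The Jacobian of the passage from chart \<open>i\<close> to chart \<open>j\<close>, kept
  as a function of \<open>x\<close> so that its derivative \<open>H\<close> at \<open>x0\<close> is
  the second derivative of the transition map.\<close>

definition "J x = frechet_derivative (transition M i j) (at x)"

definition "H u v = frechet_derivative (\<lambda>x. J x v) (at x0) u"

lemma open_overlap: "open overlap"
  using open_transition_dom idx by blast

lemma x0_overlap: "x0 \<in> overlap"
  using p by blast

lemma overlap_facts:
  assumes "x \<in> overlap"
  shows "chart_inv M i x \<in> chart_dom M i" "chart_inv M i x \<in> chart_dom M j"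
    "chart_map M i (chart_inv M i x) = x"
    "transition M i j x = chart_map M j (chart_inv M i x)"
    "chart_inv M j (transition M i j x) = chart_inv M i x"
    "transition M j i (transition M i j x) = x"
    "x \<in> chart_img M i" "transition M i j x \<in> chart_img M j"
  using assms idx by (auto simp: transition_def chart_inv_chart chart_img_def)

lemma transition_x0: "transition M i j x0 = chart_map M j p"
  using idx p by (simp add: transition_def chart_inv_chart)

lemma transition_derivative:
  assumes "x \<in> overlap"
  shows "(transition M i j has_derivative J x) (at x)"
  using assms transition_differentiable[OF idx] has_derivative_frechet unfolding J_def by blast

lemma J_linear: "x \<in> overlap \<Longrightarrow> linear (J x)"
  using transition_derivative has_derivative_linear by blast

lemma transition_Ck: "Ck_on k overlap (transition M i j)"
  using smooth_transition[OF idx] by (simp add: smooth_on_def)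

lemma J_derivative: "((\<lambda>x. J x v) has_derivative (\<lambda>u. H u v)) (at x0)"
proof -
  have "(\<lambda>x. J x v) differentiable (at x0)"
    using transition_Ck[of "Suc (Suc 0)"] x0_overlap unfolding J_def by auto
  then show ?thesis unfolding H_def by (rule has_derivative_frechet)
qed

lemma H_sym: "H u v = H v u"
  using second_derivative_symmetric[OF transition_Ck open_overlap x0_overlap] by (simp add: H_def J_def)

text \<open>The chain rule for the round trip between the charts, which is the identity on the
  overlap.\<close>

lemma J_left_inverse:
  "frechet_derivative (transition M j i) (at (chart_map M j p)) (J x0 v) = v"
proof -
  interpret ji: chart_change M j i p by unfold_locales (use idx p in auto)
  have "((\<lambda>x. transition M j i (transition M i j x)) has_derivative
      (\<lambda>v. ji.J (chart_map M j p) (J x0 v))) (at x0)"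
    using has_derivative_compose[OF transition_derivative[OF x0_overlap], of "transition M j i"]
      ji.transition_derivative[OF ji.x0_overlap] by (simp add: transition_x0)
  moreover have "((\<lambda>x. transition M j i (transition M i j x)) has_derivative (\<lambda>v. v)) (at x0)"
    by (rule has_derivative_transform_within_open[OF has_derivative_ident open_overlap x0_overlap])
       (use overlap_facts(6) in auto)
  ultimately show ?thesis
    unfolding ji.J_def using has_derivative_unique by metis
qed

text \<open>This is the left inverse for the opposite change of charts.\<close>

lemma J_right_inverse:
  "J x0 (frechet_derivative (transition M j i) (at (chart_map M j p)) v) = v"
proof -
  interpret ji: chart_change M j i p by unfold_locales (use idx p in auto)
  show ?thesis using ji.J_left_inverse by (simp add: J_def ji.J_def)
qed

lemma metric_J:
  "x \<in> overlap \<Longrightarrow> riem_metric M i (chart_inv M i x) v w =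
     riem_metric M j (chart_inv M i x) (J x v) (J x w)"
  using metric_transform[OF idx, of "chart_inv M i x" v w] overlap_facts by (simp add: J_def)

lemma metric_J_x0: "riem_metric M i p v w = riem_metric M j p (J x0 v) (J x0 w)"
  using metric_J[OF x0_overlap] idx p by (simp add: chart_inv_chart)

text \<open>\<open>J x0\<close> is onto, so the vectors \<open>J x0 w\<close> suffice as test
  vectors.\<close>

lemma metric_eqI_J:
  assumes "\<And>w. riem_metric M j p v (J x0 w) = riem_metric M j p v' (J x0 w)"
  shows "v = v'"
  by (rule metric_eqI[OF idx(2) p(2)]) (metis assms J_right_inverse)

section \<open>Transformation laws of the connection, the gradient and the Laplacian\<close>

text \<open>\<open>H\<close> is the inhomogeneous term in the transformation law of the Christoffel symbols. It cancels
  in \<open>levi_civita_transform\<close> against the derivative of the Jacobian, thanks to \<open>H_sym\<close>.\<close>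

lemma metric_deriv_transform:
  "metric_deriv M i p u v w = metric_deriv M j p (J x0 u) (J x0 v) (J x0 w)
     + riem_metric M j p (H u v) (J x0 w) + riem_metric M j p (J x0 v) (H u w)"
proof -
  \<comment> \<open>The metric coefficients of chart \<open>j\<close>, read in the coordinates of
    chart \<open>i\<close> so that the chain rule applies to them.\<close>
  let ?G = "\<lambda>x. riem_metric M j (chart_inv M j (transition M i j x))"
  have G: "?G x = riem_metric M j (chart_inv M i x)" if "x \<in> overlap" for x
    using overlap_facts(5)[OF that] by simp
  have Gx0: "?G x0 = riem_metric M j p"
    using idx p by (simp add: transition_x0 chart_inv_chart)
  have lin: "linear (?G y a)" "linear (\<lambda>a. ?G y a b)" if "y \<in> overlap" for y a b
    using overlap_facts(2)[OF that] metric_linear_left metric_linear_right idx(2) by (auto simp: G[OF that])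
  have 1: "((\<lambda>x. ?G x a b) has_derivative (\<lambda>u. metric_deriv M j p (J x0 u) a b)) (at x0)" for a b
    using has_derivative_compose[OF transition_derivative[OF x0_overlap],
        of "\<lambda>x. riem_metric M j (chart_inv M j x) a b" "\<lambda>u. metric_deriv M j p u a b"]
      metric_deriv_works[OF idx(2) p(2)] by (simp add: transition_x0)
  \<comment> \<open>The moving arguments \<open>J x w\<close> and \<open>J x v\<close> are inserted
    one at a time, since \<open>has_derivative_linear_family\<close> handles one linear
    slot.\<close>
  have 2: "((\<lambda>x. ?G x a (J x w)) has_derivative
      (\<lambda>u. metric_deriv M j p (J x0 u) a (J x0 w) + ?G x0 a (H u w))) (at x0)" for a
    by (rule has_derivative_linear_family[OF open_overlap x0_overlap lin(1) 1 J_derivative])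
  have 3: "((\<lambda>x. ?G x (J x v) (J x w)) has_derivative
      (\<lambda>u. (metric_deriv M j p (J x0 u) (J x0 v) (J x0 w) + ?G x0 (J x0 v) (H u w))
        + ?G x0 (H u v) (J x0 w))) (at x0)"
    by (rule has_derivative_linear_family[OF open_overlap x0_overlap lin(2) 2 J_derivative])
  show ?thesis
    using metric_deriv_eqI[OF idx(1) p(1) open_overlap x0_overlap _ 3, of v w u]
    by (simp add: G Gx0[simplified] metric_J)
qed

text \<open>The three metric derivatives contribute six terms in \<open>H\<close>. By symmetry of
  \<open>H\<close> and of the metric four of them cancel, and the other two are equal and pair
  \<open>H u v\<close> with \<open>J x0 w\<close>.\<close>

lemma christoffel_transform:
  "J x0 (christoffel M i p u v) = christoffel M j p (J x0 u) (J x0 v) + H u v"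
proof (rule metric_eqI_J)
  fix w
  have "riem_metric M j p (J x0 (christoffel M i p u v)) (J x0 w)
      = riem_metric M i p (christoffel M i p u v) w"
    by (simp add: metric_J_x0)
  also have "\<dots> = riem_metric M j p (christoffel M j p (J x0 u) (J x0 v)) (J x0 w)
      + riem_metric M j p (H u v) (J x0 w)"
    using metric_sym[OF idx(2) p(2), of "J x0 u" "H v w"] metric_sym[OF idx(2) p(2), of "J x0 v" "H u w"]
      metric_sym[OF idx(2) p(2), of "J x0 v" "H w u"]
    by (simp add: christoffel_works[OF idx(1) p(1)] christoffel_works[OF idx(2) p(2)]
        metric_deriv_transform H_sym[of v u] H_sym[of w] field_simps)
  also have "\<dots> = riem_metric M j p (christoffel M j p (J x0 u) (J x0 v) + H u v) (J x0 w)"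
    by (simp add: linear_add[OF metric_linear_left[OF idx(2) p(2)]])
  finally show "riem_metric M j p (J x0 (christoffel M i p u v)) (J x0 w)
      = riem_metric M j p (christoffel M j p (J x0 u) (J x0 v) + H u v) (J x0 w)" .
qed

text \<open>The representation of \<open>X\<close> in chart \<open>j\<close> is differentiated in
  two ways: by the chain rule along the transition map, and by the product rule as
  \<open>J x\<close> applied to the representation in chart \<open>i\<close>.\<close>

lemma levi_civita_transform:
  assumes X: "\<And>x. x \<in> overlap \<Longrightarrow> X j (chart_inv M i x) = J x (X i (chart_inv M i x))"
    and di: "(\<lambda>x. X i (chart_inv M i x)) differentiable (at x0)"
    and dj: "(\<lambda>x. X j (chart_inv M j x)) differentiable (at (chart_map M j p))"
  shows "levi_civita M X j p (J x0 u) = J x0 (levi_civita M X i p u)"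
proof -
  let ?Di = "frechet_derivative (\<lambda>x. X i (chart_inv M i x)) (at x0)"
  let ?Dj = "frechet_derivative (\<lambda>x. X j (chart_inv M j x)) (at (chart_map M j p))"
  have Xp: "X j p = J x0 (X i p)"
    using X[OF x0_overlap] idx p by (simp add: chart_inv_chart)
  have "((\<lambda>x. X j (chart_inv M j (transition M i j x))) has_derivative (\<lambda>u. ?Dj (J x0 u))) (at x0)"
    using has_derivative_compose[OF transition_derivative[OF x0_overlap],
        of "\<lambda>x. X j (chart_inv M j x)"] has_derivative_frechet[OF dj]
    by (simp add: transition_x0)
  moreover have "((\<lambda>x. X j (chart_inv M j (transition M i j x))) has_derivative
      (\<lambda>u. H u (X i (chart_inv M i x0)) + J x0 (?Di u))) (at x0)"
  proof (rule has_derivative_transform_within_open[OF _ open_overlap x0_overlap])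
    show "((\<lambda>x. J x (X i (chart_inv M i x))) has_derivative
        (\<lambda>u. H u (X i (chart_inv M i x0)) + J x0 (?Di u))) (at x0)"
      by (rule has_derivative_linear_family[OF open_overlap x0_overlap J_linear J_derivative
          has_derivative_frechet[OF di]])
  qed (simp add: overlap_facts(5) X)
  ultimately have "(\<lambda>u. ?Dj (J x0 u)) = (\<lambda>u. H u (X i (chart_inv M i x0)) + J x0 (?Di u))"
    by (rule has_derivative_unique)
  then have "?Dj (J x0 u) = H u (X i p) + J x0 (?Di u)"
    using idx p by (simp add: chart_inv_chart fun_eq_iff)
  moreover have "J x0 (?Di u + christoffel M i p u (X i p)) = J x0 (?Di u) + J x0 (christoffel M i p u (X i p))"
    by (rule linear_add[OF J_linear[OF x0_overlap]])
  ultimately show ?thesis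
    by (simp add: levi_civita_def Xp christoffel_transform)
qed

text \<open>The differential transforms by the chain rule, and \<open>J x0\<close> is an isometry
  for the two component metrics.\<close>

lemma grad_transform:
  assumes f: "Ck_on_mfd 2 M f"
  shows "grad M f j p = J x0 (grad M f i p)"
proof (rule metric_eqI_J)
  fix w
  note d = Ck_differentiable[OF f[unfolded numeral_2_eq_2]]
  have "((\<lambda>x. (f \<circ> chart_inv M j) (transition M i j x)) has_derivative
      (\<lambda>u. differential M f j p (J x0 u))) (at x0)"
    using has_derivative_compose[OF transition_derivative[OF x0_overlap], of "f \<circ> chart_inv M j"]
      has_derivative_frechet[OF d[OF idx(2) chart_in_img[OF p(2)]]]
    by (simp add: transition_x0)
  then have "((f \<circ> chart_inv M i) has_derivative (\<lambda>u. differential M f j p (J x0 u))) (at x0)"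
    by (rule has_derivative_transform_within_open[OF _ open_overlap x0_overlap])
       (simp add: overlap_facts(5))
  from frechet_derivative_eqI[OF this]
  show "riem_metric M j p (grad M f j p) (J x0 w) = riem_metric M j p (J x0 (grad M f i p)) (J x0 w)"
    using idx p by (simp add: grad_works d chart_in_img flip: metric_J_x0)
qed

text \<open>The endomorphisms given by the covariant derivative of the gradient in the two charts
  are conjugate by \<open>J x0\<close>, so their traces agree.\<close>

lemma laplacian_transform:
  assumes f: "Ck_on_mfd 2 M f"
  shows "laplacian M j f p = laplacian M i f p"
proof -
  let ?K = "frechet_derivative (transition M j i) (at (chart_map M j p))"
  let ?Li = "levi_civita M (grad M f) i p" and ?Lj = "levi_civita M (grad M f) j p"
  have K: "linear ?K"
    using transition_differentiable[OF idx(2,1), of p] p by (intro linear_frechet_derivative) auto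
  \<comment> \<open>The gradients are differentiated next, so they are compared on the whole
    overlap, with an instance of the locale at each point.\<close>
  have grad: "grad M f j (chart_inv M i x) = J x (grad M f i (chart_inv M i x))" if "x \<in> overlap" for x
  proof -
    interpret q: chart_change M i j "chart_inv M i x"
      by unfold_locales (use idx overlap_facts[OF that] in auto)
    show ?thesis
      using q.grad_transform[OF f] overlap_facts[OF that] by (simp add: J_def q.J_def)
  qed
  note d = grad_differentiable[OF _ chart_in_img f]
  have "?Lj (J x0 u) = J x0 (?Li u)" for u
    by (rule levi_civita_transform[OF grad d[OF idx(1) p(1)] d[OF idx(2) p(2)]])
  from this[of "?K _"] have "?Lj = J x0 \<circ> (?Li \<circ> ?K)"
    by (simp add: fun_eq_iff J_right_inverse)
  then have "lin_trace ?Lj = lin_trace ((?Li \<circ> ?K) \<circ> J x0)"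
    using lin_trace_compose_commute[OF J_linear[OF x0_overlap] linear_compose[OF K
        levi_civita_linear[where X = "grad M f", OF idx(1) p(1) d[OF idx(1) p(1)]]]]
    by simp
  also have "(?Li \<circ> ?K) \<circ> J x0 = ?Li"
    using J_left_inverse by (simp add: fun_eq_iff)
  finally show ?thesis by (simp add: laplacian_def)
qed

end

context riemannian_manifold
begin

text \<open>This shape serves the real part of a complex product with \<open>c = - 1\<close> and the
  imaginary part with \<open>c = 1\<close>.\<close>

lemma grad_combination:
  assumes i: "i \<in> chart_idx M" "p \<in> chart_dom M i"
    and f: "Ck_on_mfd 2 M f" and g: "Ck_on_mfd 2 M g"
  shows "grad M (\<lambda>q. f q + c * g q) i p = grad M f i p + c *\<^sub>R grad M g i p"
proof (rule grad_eqI[OF i])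
  note d = grad_has_derivative[OF i Ck_differentiable[OF _ i(1) chart_in_img[OF i(2)]]]
  have "((\<lambda>x. (f \<circ> chart_inv M i) x + c *\<^sub>R (g \<circ> chart_inv M i) x) has_derivative
      (\<lambda>w. riem_metric M i p (grad M f i p) w + c *\<^sub>R riem_metric M i p (grad M g i p) w)) (at (chart_map M i p))"
    using f g unfolding numeral_2_eq_2
    by (intro has_derivative_add has_derivative_scaleR_right d)
  also have "(\<lambda>w. riem_metric M i p (grad M f i p) w + c *\<^sub>R riem_metric M i p (grad M g i p) w)
      = riem_metric M i p (grad M f i p + c *\<^sub>R grad M g i p)"
    by (simp add: fun_eq_iff linear_add[OF metric_linear_left[OF i]] linear_scale[OF metric_linear_left[OF i]])
  finally show "((\<lambda>q. f q + c * g q) \<circ> chart_inv M i has_derivative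
      riem_metric M i p (grad M f i p + c *\<^sub>R grad M g i p)) (at (chart_map M i p))"
    by (simp add: comp_def)
qed

lemma laplacian_combination:
  assumes i: "i \<in> chart_idx M" "p \<in> chart_dom M i"
    and f: "Ck_on_mfd 2 M f" and g: "Ck_on_mfd 2 M g"
  shows "laplacian M i (\<lambda>q. f q + c * g q) p = laplacian M i f p + c * laplacian M i g p"
proof -
  let ?D = "\<lambda>f. frechet_derivative (\<lambda>x. grad M f i (chart_inv M i x)) (at (chart_map M i p))"
  note d = has_derivative_frechet[OF grad_differentiable[OF i(1) chart_in_img[OF i(2)]]]
  \<comment> \<open>\<open>grad_combination\<close> is used on the whole chart image, not only at
    \<open>p\<close>, so that it can be differentiated.\<close>
  have "((\<lambda>x. grad M (\<lambda>q. f q + c * g q) i (chart_inv M i x)) has_derivative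
      (\<lambda>u. ?D f u + c *\<^sub>R ?D g u)) (at (chart_map M i p))"
    by (rule has_derivative_transform_within_open[OF
          has_derivative_add[OF d[OF f] has_derivative_scaleR_right[OF d[OF g]]]
          open_chart_img[OF i(1)] chart_in_img[OF i(2)]])
       (simp add: grad_combination[OF i(1) chart_inv_in_dom f g])
  from frechet_derivative_eqI[OF this]
  have "levi_civita M (grad M (\<lambda>q. f q + c * g q)) i p =
      (\<lambda>u. levi_civita M (grad M f) i p u + c *\<^sub>R levi_civita M (grad M g) i p u)"
    by (simp add: levi_civita_def fun_eq_iff grad_combination[OF i f g] scaleR_add_right
        linear_add[OF christoffel_linear(2)[OF i]] linear_scale[OF christoffel_linear(2)[OF i]])
  then show ?thesis by (simp add: laplacian_def lin_trace_add lin_trace_scale)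
qed

lemma Ck_on_mfd_bounded_linear:
  "bounded_linear h \<Longrightarrow> Ck_on_mfd k M f \<Longrightarrow> Ck_on_mfd k M (\<lambda>q. h (f q))"
  using Ck_on_bounded_linear[of h "chart_img M _" k "f \<circ> chart_inv M _"] open_chart_img
  by (simp add: Ck_on_mfd_def comp_def)

lemma Ck_on_mfd_Re: "Ck_on_mfd k M \<phi> \<Longrightarrow> Ck_on_mfd k M (\<lambda>q. Re (\<phi> q))"
  and Ck_on_mfd_Im: "Ck_on_mfd k M \<phi> \<Longrightarrow> Ck_on_mfd k M (\<lambda>q. Im (\<phi> q))"
  by (rule Ck_on_mfd_bounded_linear[OF bounded_linear_Re], assumption)
     (rule Ck_on_mfd_bounded_linear[OF bounded_linear_Im])

lemma chart_at:
  assumes "p \<in> points M"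
  shows "chart_at M p \<in> chart_idx M" "p \<in> chart_dom M (chart_at M p)"
proof -
  have "\<exists>i. i \<in> chart_idx M \<and> p \<in> chart_dom M i" using assms charts_cover by auto
  from someI_ex[OF this] show "chart_at M p \<in> chart_idx M" "p \<in> chart_dom M (chart_at M p)"
    by (auto simp: chart_at_def)
qed

lemma chart_change_chart_at:
  assumes "i \<in> chart_idx M" "p \<in> chart_dom M i"
  shows "chart_change M i (chart_at M p) p"
proof -
  have "p \<in> points M" using assms charts_cover by auto
  then show ?thesis using assms chart_at by unfold_locales auto
qed

text \<open>Replaces the chart picked by \<open>chart_at\<close> by one of choice, so that charts of
  the factors and of the product can be matched.\<close>

lemma tension_in_chart:
  assumes i: "i \<in> chart_idx M" "p \<in> chart_dom M i" and \<phi>: "Ck_on_mfd 2 M \<phi>"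
  shows "tension M \<phi> p = Complex (laplacian M i (\<lambda>q. Re (\<phi> q)) p) (laplacian M i (\<lambda>q. Im (\<phi> q)) p)"
proof -
  interpret chart_change M i "chart_at M p" p using chart_change_chart_at[OF i] .
  show ?thesis
    using laplacian_transform Ck_on_mfd_Re[OF \<phi>] Ck_on_mfd_Im[OF \<phi>]
    by (simp add: tension_def cdivergence_def cgrad_def divergence_def laplacian_def)
qed

lemma conformality_in_chart:
  assumes i: "i \<in> chart_idx M" "p \<in> chart_dom M i"
    and \<phi>: "Ck_on_mfd 2 M \<phi>" and \<psi>: "Ck_on_mfd 2 M \<psi>"
  shows "conformality M \<phi> \<psi> p = cmetric M i p (cgrad M \<phi> i p) (cgrad M \<psi> i p)"
proof -
  interpret chart_change M i "chart_at M p" p using chart_change_chart_at[OF i] .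
  show ?thesis
    using grad_transform Ck_on_mfd_Re[OF \<phi>] Ck_on_mfd_Im[OF \<phi>] Ck_on_mfd_Re[OF \<psi>] Ck_on_mfd_Im[OF \<psi>]
    by (simp add: conformality_def cmetric_def cgrad_def metric_J_x0)
qed

end


section \<open>Products\<close>

locale riemannian_pair =
  M1: riemannian_manifold M1 + M2: riemannian_manifold M2
  for M1 :: "('a, 'i, 'e::euclidean_space) riem_mfd"
    and M2 :: "('b, 'j, 'f::euclidean_space) riem_mfd"
begin

abbreviation "N \<equiv> riemannian_product M1 M2"

sublocale N: riemannian_manifold N
  by (rule riemannian_manifold_product) unfold_locales

lemma chart_inv_product:
  assumes "i \<in> chart_idx M1" "j \<in> chart_idx M2" "z \<in> chart_img M1 i \<times> chart_img M2 j"
  shows "chart_inv N (i, j) z = (chart_inv M1 i (fst z), chart_inv M2 j (snd z))"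
proof -
  have "chart_map N (i, j) (chart_inv M1 i (fst z), chart_inv M2 j (snd z)) = z"
    using assms by (auto simp: M1.chart_chart_inv M2.chart_chart_inv)
  moreover have "(chart_inv M1 i (fst z), chart_inv M2 j (snd z)) \<in> chart_dom N (i, j)"
    using assms by (auto intro: M1.chart_inv_in_dom M2.chart_inv_in_dom)
  ultimately show ?thesis using N.chart_inv_chart[of "(i, j)"] assms by fastforce
qed

text \<open>The algebra is general because the rule is applied to complex functions and to their
  real and imaginary parts.\<close>

lemma Ck_on_mfd_product:
  fixes f :: "'a \<Rightarrow> 'c::real_normed_algebra" and g :: "'b \<Rightarrow> 'c"
  assumes "Ck_on_mfd k M1 f" "Ck_on_mfd k M2 g"
  shows "Ck_on_mfd k N (\<lambda>(p, q). f p * g q)"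
  unfolding Ck_on_mfd_def
proof
  fix a assume "a \<in> chart_idx N"
  then obtain i j where a: "a = (i, j)" and ij: "i \<in> chart_idx M1" "j \<in> chart_idx M2" by auto
  note o = M1.open_chart_img[OF ij(1)] M2.open_chart_img[OF ij(2)]
  have "Ck_on k (chart_img M1 i \<times> chart_img M2 j)
      (\<lambda>z. (f \<circ> chart_inv M1 i) (fst z) * (g \<circ> chart_inv M2 j) (snd z))"
    using assms ij by (intro Ck_on_prod_bilinear[OF bounded_bilinear_mult o]) (auto simp: Ck_on_mfd_def comp_def)
  then show "Ck_on k (chart_img N a) ((\<lambda>(p, q). f p * g q) \<circ> chart_inv N a)"
    unfolding a riemannian_product_simps
    by (rule Ck_on_cong[OF open_Times[OF o], rotated]) (simp add: chart_inv_product[OF ij])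
qed

context
  fixes i j p q
  assumes i: "i \<in> chart_idx M1" "p \<in> chart_dom M1 i" and j: "j \<in> chart_idx M2" "q \<in> chart_dom M2 j"
begin

lemma ij: "(i, j) \<in> chart_idx N" "(p, q) \<in> chart_dom N (i, j)"
  using i j by auto

lemma chart_box: "open (chart_img M1 i \<times> chart_img M2 j)"
  "chart_map N (i, j) (p, q) \<in> chart_img M1 i \<times> chart_img M2 j"
  using i j by (auto simp: open_Times M1.open_chart_img M2.open_chart_img M1.chart_in_img M2.chart_in_img)

lemma metric_deriv_product:
  "metric_deriv N (i, j) (p, q) u v w =
    metric_deriv M1 i p (fst u) (fst v) (fst w) + metric_deriv M2 j q (snd u) (snd v) (snd w)"
proof (rule N.metric_deriv_eqI[OF ij chart_box])
  show "((\<lambda>z. riem_metric M1 i (chart_inv M1 i (fst z)) (fst v) (fst w)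
        + riem_metric M2 j (chart_inv M2 j (snd z)) (snd v) (snd w)) has_derivative
      (\<lambda>u. metric_deriv M1 i p (fst u) (fst v) (fst w) + metric_deriv M2 j q (snd u) (snd v) (snd w)))
      (at (chart_map N (i, j) (p, q)))"
    using M1.metric_deriv_works[OF i] M2.metric_deriv_works[OF j]
    by (intro has_derivative_add
        has_derivative_compose[of fst fst _ UNIV "\<lambda>x. riem_metric M1 i (chart_inv M1 i x) (fst v) (fst w)"]
        has_derivative_compose[of snd snd _ UNIV "\<lambda>x. riem_metric M2 j (chart_inv M2 j x) (snd v) (snd w)"]
        bounded_linear_imp_has_derivative bounded_linear_fst bounded_linear_snd) simp_all
qed (simp add: chart_inv_product[OF i(1) j(1)])

text \<open>The Koszul expression of the product splits into those of the factors, so the pair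
  solves the defining equation.\<close>

lemma christoffel_product:
  "christoffel N (i, j) (p, q) u v =
    (christoffel M1 i p (fst u) (fst v), christoffel M2 j q (snd u) (snd v))"
  by (rule N.christoffel_eqI[OF ij])
     (simp add: metric_deriv_product M1.christoffel_works[OF i] M2.christoffel_works[OF j]
       add_divide_distrib diff_divide_distrib)

lemma grad_product:
  assumes f: "Ck_on_mfd 2 M1 f" and g: "Ck_on_mfd 2 M2 g"
  shows "grad N (\<lambda>(p, q). f p * g q) (i, j) (p, q) = (g q *\<^sub>R grad M1 f i p, f p *\<^sub>R grad M2 g j q)"
proof (rule N.grad_eqI[OF ij], rule has_derivative_transform_within_open[OF _ chart_box])
  let ?z = "chart_map N (i, j) (p, q)"
  have z: "chart_inv M1 i (fst ?z) = p" "chart_inv M2 j (snd ?z) = q"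
    using i j by (auto simp: M1.chart_inv_chart M2.chart_inv_chart)
  have "((\<lambda>z. (f \<circ> chart_inv M1 i) (fst z) * (g \<circ> chart_inv M2 j) (snd z)) has_derivative
      (\<lambda>v. (f \<circ> chart_inv M1 i) (fst ?z) * riem_metric M2 j q (grad M2 g j q) (snd v) +
           riem_metric M1 i p (grad M1 f i p) (fst v) * (g \<circ> chart_inv M2 j) (snd ?z))) (at ?z)"
    using M1.grad_has_derivative[OF i M1.Ck_differentiable[OF f[unfolded numeral_2_eq_2] i(1) M1.chart_in_img[OF i(2)]]]
      M2.grad_has_derivative[OF j M2.Ck_differentiable[OF g[unfolded numeral_2_eq_2] j(1) M2.chart_in_img[OF j(2)]]]
    by (intro has_derivative_prod_bilinear[OF bounded_bilinear_mult]) (simp_all add: comp_def)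
  also have "(\<lambda>v. (f \<circ> chart_inv M1 i) (fst ?z) * riem_metric M2 j q (grad M2 g j q) (snd v) +
           riem_metric M1 i p (grad M1 f i p) (fst v) * (g \<circ> chart_inv M2 j) (snd ?z)) =
      riem_metric N (i, j) (p, q) (g q *\<^sub>R grad M1 f i p, f p *\<^sub>R grad M2 g j q)"
    using z by (simp add: fun_eq_iff linear_scale[OF M1.metric_linear_left[OF i]]
        linear_scale[OF M2.metric_linear_left[OF j]])
  finally show "((\<lambda>z. (f \<circ> chart_inv M1 i) (fst z) * (g \<circ> chart_inv M2 j) (snd z)) has_derivative
      riem_metric N (i, j) (p, q) (g q *\<^sub>R grad M1 f i p, f p *\<^sub>R grad M2 g j q)) (at ?z)" .
qed (simp add: chart_inv_product[OF i(1) j(1)])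

end

text \<open>The mixed terms of \<open>\<nabla>(g grad f, f grad g)\<close> are off the diagonal and have no trace.\<close>

lemma laplacian_product:
  assumes i: "i \<in> chart_idx M1" "p \<in> chart_dom M1 i" and j: "j \<in> chart_idx M2" "q \<in> chart_dom M2 j"
    and f: "Ck_on_mfd 2 M1 f" and g: "Ck_on_mfd 2 M2 g"
  shows "laplacian N (i, j) (\<lambda>(p, q). f p * g q) (p, q) = g q * laplacian M1 i f p + f p * laplacian M2 j g q"
proof -
  define F G X Y where "F = f \<circ> chart_inv M1 i" and "G = g \<circ> chart_inv M2 j"
    and "X = (\<lambda>x. grad M1 f i (chart_inv M1 i x))" and "Y = (\<lambda>y. grad M2 g j (chart_inv M2 j y))"
  let ?h = "\<lambda>(p, q). f p * g q" and ?x = "chart_map M1 i p" and ?y = "chart_map M2 j q"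
  let ?z = "(?x, ?y)"
  have at: "F ?x = f p" "G ?y = g q" "X ?x = grad M1 f i p" "Y ?y = grad M2 g j q"
    using i j by (simp_all add: F_def G_def X_def Y_def M1.chart_inv_chart M2.chart_inv_chart)
  have dF: "(F has_derivative differential M1 f i p) (at ?x)"
    unfolding F_def using M1.Ck_differentiable[OF f[unfolded numeral_2_eq_2] i(1) M1.chart_in_img[OF i(2)]]
    by (rule has_derivative_frechet)
  have dG: "(G has_derivative differential M2 g j q) (at ?y)"
    unfolding G_def using M2.Ck_differentiable[OF g[unfolded numeral_2_eq_2] j(1) M2.chart_in_img[OF j(2)]]
    by (rule has_derivative_frechet)
  have dX: "(X has_derivative frechet_derivative X (at ?x)) (at ?x)"
    unfolding X_def by (intro has_derivative_frechet M1.grad_differentiable i M1.chart_in_img f)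
  have dY: "(Y has_derivative frechet_derivative Y (at ?y)) (at ?y)"
    unfolding Y_def by (intro has_derivative_frechet M2.grad_differentiable j M2.chart_in_img g)
  have "((\<lambda>z. (G (snd z) *\<^sub>R X (fst z), F (fst z) *\<^sub>R Y (snd z))) has_derivative
    (\<lambda>u. (differential M2 g j q (snd u) *\<^sub>R X ?x + G ?y *\<^sub>R frechet_derivative X (at ?x) (fst u),
         F ?x *\<^sub>R frechet_derivative Y (at ?y) (snd u) + differential M1 f i p (fst u) *\<^sub>R Y ?y))) (at ?z)"
    \<comment> \<open>In the first component the scalar depends on the second variable, hence the
      flipped scalar multiplication.\<close>
    using has_derivative_prod_bilinear[OF bounded_bilinear.flip[OF bounded_bilinear_scaleR], of X _ ?z G] dX dG
      has_derivative_prod_bilinear[OF bounded_bilinear_scaleR, of F _ ?z Y] dF dY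
    by (intro has_derivative_Pair) simp_all
  then have "((\<lambda>z. grad N ?h (i, j) (chart_inv N (i, j) z)) has_derivative
    (\<lambda>u. (differential M2 g j q (snd u) *\<^sub>R X ?x + G ?y *\<^sub>R frechet_derivative X (at ?x) (fst u),
         F ?x *\<^sub>R frechet_derivative Y (at ?y) (snd u) + differential M1 f i p (fst u) *\<^sub>R Y ?y))) (at ?z)"
  proof (rule has_derivative_transform_within_open[OF _ chart_box(1)[OF i j]])
    show "?z \<in> chart_img M1 i \<times> chart_img M2 j" using chart_box(2)[OF i j] by simp
    show "(G (snd z) *\<^sub>R X (fst z), F (fst z) *\<^sub>R Y (snd z)) = grad N ?h (i, j) (chart_inv N (i, j) z)"
      if z: "z \<in> chart_img M1 i \<times> chart_img M2 j" for z
    proof -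
      have "chart_inv M1 i (fst z) \<in> chart_dom M1 i" "chart_inv M2 j (snd z) \<in> chart_dom M2 j"
        using z by (auto intro: M1.chart_inv_in_dom M2.chart_inv_in_dom)
      from grad_product[OF i(1) this(1) j(1) this(2) f g] show ?thesis
        by (simp add: chart_inv_product[OF i(1) j(1) z] F_def G_def X_def Y_def)
    qed
  qed
  from frechet_derivative_eqI[OF this]
  have "levi_civita N (grad N ?h) (i, j) (p, q) =
    (\<lambda>u. (differential M2 g j q (snd u) *\<^sub>R X ?x + g q *\<^sub>R levi_civita M1 (grad M1 f) i p (fst u),
         f p *\<^sub>R levi_civita M2 (grad M2 g) j q (snd u) + differential M1 f i p (fst u) *\<^sub>R Y ?y))"
    by (simp add: levi_civita_def fun_eq_iff christoffel_product[OF i j] grad_product[OF i j f g] at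
        X_def[symmetric] Y_def[symmetric] algebra_simps
        linear_scale[OF M1.christoffel_linear(2)[OF i]] linear_scale[OF M2.christoffel_linear(2)[OF j]])
  \<comment> \<open>In \<open>lin_trace_Pair\<close> the argument from the other factor is 0, and
    there the mixed terms vanish by linearity of the differentials.\<close>
  moreover have "differential M2 g j q 0 = 0" "differential M1 f i p 0 = 0"
    using dF dG has_derivative_linear linear_0 by blast+
  ultimately show ?thesis
    using lin_trace_Pair[of "\<lambda>u v. differential M2 g j q v *\<^sub>R X ?x + g q *\<^sub>R levi_civita M1 (grad M1 f) i p u"
        "\<lambda>u v. f p *\<^sub>R levi_civita M2 (grad M2 g) j q v + differential M1 f i p u *\<^sub>R Y ?y"]
    by (simp add: laplacian_def lin_trace_scale)
qed

text \<open>The coefficients \<open>- 1\<close> and \<open>1\<close> are written out to match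
  \<open>grad_combination\<close> and \<open>laplacian_combination\<close>.\<close>

lemma Re_product: "(\<lambda>z. Re ((\<lambda>(p, q). \<phi>1 p * \<phi>2 q) z)) =
    (\<lambda>z. (\<lambda>(p, q). Re (\<phi>1 p) * Re (\<phi>2 q)) z + (- 1) * (\<lambda>(p, q). Im (\<phi>1 p) * Im (\<phi>2 q)) z)"
  and Im_product: "(\<lambda>z. Im ((\<lambda>(p, q). \<phi>1 p * \<phi>2 q) z)) =
    (\<lambda>z. (\<lambda>(p, q). Re (\<phi>1 p) * Im (\<phi>2 q)) z + 1 * (\<lambda>(p, q). Im (\<phi>1 p) * Re (\<phi>2 q)) z)"
  by (auto simp: fun_eq_iff)

text \<open>The four real products of real and imaginary parts are treated by
  \<open>laplacian_product\<close> and recombined. No mixed gradient term arises, as the gradients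
  of the two factors are orthogonal.\<close>

lemma tension_product:
  assumes pq: "p \<in> points M1" "q \<in> points M2"
    and \<phi>: "Ck_on_mfd 2 M1 \<phi>1" "Ck_on_mfd 2 M2 \<phi>2"
  shows "tension N (\<lambda>(p, q). \<phi>1 p * \<phi>2 q) (p, q) = tension M1 \<phi>1 p * \<phi>2 q + \<phi>1 p * tension M2 \<phi>2 q"
proof -
  obtain i j where i: "i \<in> chart_idx M1" "p \<in> chart_dom M1 i" and j: "j \<in> chart_idx M2" "q \<in> chart_dom M2 j"
    using pq M1.charts_cover M2.charts_cover by auto
  note C = M1.Ck_on_mfd_Re[OF \<phi>(1)] M1.Ck_on_mfd_Im[OF \<phi>(1)] M2.Ck_on_mfd_Re[OF \<phi>(2)] M2.Ck_on_mfd_Im[OF \<phi>(2)]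
  show ?thesis
    unfolding N.tension_in_chart[OF ij[OF i j] Ck_on_mfd_product[OF \<phi>]] Re_product Im_product
      N.laplacian_combination[OF ij[OF i j] Ck_on_mfd_product[OF C(1,3)] Ck_on_mfd_product[OF C(2,4)]]
      N.laplacian_combination[OF ij[OF i j] Ck_on_mfd_product[OF C(1,4)] Ck_on_mfd_product[OF C(2,3)]]
      laplacian_product[OF i j C(1,3)] laplacian_product[OF i j C(2,4)]
      laplacian_product[OF i j C(1,4)] laplacian_product[OF i j C(2,3)]
      M1.tension_in_chart[OF i \<phi>(1)] M2.tension_in_chart[OF j \<phi>(2)]
    by (simp add: complex_eq_iff algebra_simps)
qed

text \<open>The two blocks are orthogonal in the product metric, and in each block the
  undifferentiated factors come out by complex bilinearity.\<close>

lemma conformality_product: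
  assumes pq: "p \<in> points M1" "q \<in> points M2"
    and \<phi>: "Ck_on_mfd 2 M1 \<phi>1" "Ck_on_mfd 2 M2 \<phi>2"
    and \<psi>: "Ck_on_mfd 2 M1 \<psi>1" "Ck_on_mfd 2 M2 \<psi>2"
  shows "conformality N (\<lambda>(p, q). \<phi>1 p * \<phi>2 q) (\<lambda>(p, q). \<psi>1 p * \<psi>2 q) (p, q) =
    conformality M1 \<phi>1 \<psi>1 p * (\<phi>2 q * \<psi>2 q) + (\<phi>1 p * \<psi>1 p) * conformality M2 \<phi>2 \<psi>2 q"
proof -
  obtain i j where i: "i \<in> chart_idx M1" "p \<in> chart_dom M1 i" and j: "j \<in> chart_idx M2" "q \<in> chart_dom M2 j"
    using pq M1.charts_cover M2.charts_cover by auto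
  \<comment> \<open>The components are the real and imaginary parts of \<phi>2 times the complex
    gradient of \<phi>1, and of \<phi>1 times that of \<phi>2.\<close>
  have cgrad: "cgrad N (\<lambda>(p, q). \<phi>1 p * \<phi>2 q) (i, j) (p, q) = CVec
      (Re (\<phi>2 q) *\<^sub>R re_vec (cgrad M1 \<phi>1 i p) - Im (\<phi>2 q) *\<^sub>R im_vec (cgrad M1 \<phi>1 i p),
       Re (\<phi>1 p) *\<^sub>R re_vec (cgrad M2 \<phi>2 j q) - Im (\<phi>1 p) *\<^sub>R im_vec (cgrad M2 \<phi>2 j q))
      (Im (\<phi>2 q) *\<^sub>R re_vec (cgrad M1 \<phi>1 i p) + Re (\<phi>2 q) *\<^sub>R im_vec (cgrad M1 \<phi>1 i p),
       Re (\<phi>1 p) *\<^sub>R im_vec (cgrad M2 \<phi>2 j q) + Im (\<phi>1 p) *\<^sub>R re_vec (cgrad M2 \<phi>2 j q))"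
    if \<phi>: "Ck_on_mfd 2 M1 \<phi>1" "Ck_on_mfd 2 M2 \<phi>2" for \<phi>1 \<phi>2
  proof -
    note C = M1.Ck_on_mfd_Re[OF \<phi>(1)] M1.Ck_on_mfd_Im[OF \<phi>(1)] M2.Ck_on_mfd_Re[OF \<phi>(2)] M2.Ck_on_mfd_Im[OF \<phi>(2)]
    show ?thesis
      unfolding cgrad_def Re_product Im_product
        N.grad_combination[OF ij[OF i j] Ck_on_mfd_product[OF C(1,3)] Ck_on_mfd_product[OF C(2,4)]]
        N.grad_combination[OF ij[OF i j] Ck_on_mfd_product[OF C(1,4)] Ck_on_mfd_product[OF C(2,3)]]
        grad_product[OF i j C(1,3)] grad_product[OF i j C(2,4)]
        grad_product[OF i j C(1,4)] grad_product[OF i j C(2,3)]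
      by simp
  qed
  note lin = M1.metric_linear_left[OF i] M1.metric_linear_right[OF i]
    M2.metric_linear_left[OF j] M2.metric_linear_right[OF j]
  note bil = lin[THEN linear_add] lin[THEN linear_diff] lin[THEN linear_scale]
  show ?thesis
    unfolding N.conformality_in_chart[OF ij[OF i j] Ck_on_mfd_product[OF \<phi>] Ck_on_mfd_product[OF \<psi>]]
      M1.conformality_in_chart[OF i \<phi>(1) \<psi>(1)] M2.conformality_in_chart[OF j \<phi>(2) \<psi>(2)]
      cgrad[OF \<phi>] cgrad[OF \<psi>] cmetric_def
    by (simp add: complex_eq_iff bil algebra_simps)
qed

end

theorem theorem11p1:
  fixes M1 :: "('a, 'i, 'e::euclidean_space) riem_mfd"
    and M2 :: "('b, 'j, 'f::euclidean_space) riem_mfd"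
    and N :: "('a \<times> 'b, 'i \<times> 'j, 'e \<times> 'f) riem_mfd"
    and lam1 \<mu>1 lam2 \<mu>2 :: complex
    and \<E>1 :: "('a \<Rightarrow> complex) set" and \<E>2 :: "('b \<Rightarrow> complex) set"
    and \<E> :: "('a \<times> 'b \<Rightarrow> complex) set"
  assumes "riemannian_manifold M1" and "riemannian_manifold M2"
    and "N = riemannian_product M1 M2"
    and "eigenfamily M1 lam1 \<mu>1 \<E>1" and "eigenfamily M2 lam2 \<mu>2 \<E>2"
    and "\<E> = {\<phi>. \<exists>\<phi>1\<in>\<E>1. \<exists>\<phi>2\<in>\<E>2. \<phi> = (\<lambda>(p1, p2). \<phi>1 p1 * \<phi>2 p2)}"
  shows "eigenfamily N (lam1 + lam2) (\<mu>1 + \<mu>2) \<E>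
    \<and> (\<forall>\<phi>\<in>\<E>. \<forall>p\<in>points N. tension N \<phi> p = (lam1 + lam2) * \<phi> p)
    \<and> (\<forall>\<phi>\<in>\<E>. \<forall>\<psi>\<in>\<E>. \<forall>p\<in>points N. conformality N \<phi> \<psi> p = (\<mu>1 + \<mu>2) * (\<phi> p * \<psi> p))"
proof -
  interpret riemannian_pair M1 M2 using assms(1,2) by (rule riemannian_pair.intro)
  note E1 = assms(4)[unfolded eigenfamily_def] and E2 = assms(5)[unfolded eigenfamily_def]
  have C: "Ck_on_mfd 2 N \<phi>" if "\<phi> \<in> \<E>" for \<phi>
    using that E1 E2 Ck_on_mfd_product unfolding assms(3,6) by blast
  have T: "tension N \<phi> p = (lam1 + lam2) * \<phi> p" if \<phi>: "\<phi> \<in> \<E>" and p: "p \<in> points N" for \<phi> p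
  proof -
    obtain \<phi>1 \<phi>2 where \<phi>: "\<phi>1 \<in> \<E>1" "\<phi>2 \<in> \<E>2" "\<phi> = (\<lambda>(p1, p2). \<phi>1 p1 * \<phi>2 p2)"
      using \<phi> assms(6) by blast
    obtain p1 p2 where p: "p = (p1, p2)" "p1 \<in> points M1" "p2 \<in> points M2"
      using p assms(3) by auto
    \<comment> \<open>By the eigenvalue equations the two summands are \<open>lam1\<close> and
      \<open>lam2\<close> times the same product.\<close>
    show ?thesis
      using tension_product[OF p(2,3), of \<phi>1 \<phi>2] E1 E2 \<phi> p assms(3) by (simp add: algebra_simps)
  qed
  have K: "conformality N \<phi> \<psi> p = (\<mu>1 + \<mu>2) * (\<phi> p * \<psi> p)"
    if \<phi>: "\<phi> \<in> \<E>" and \<psi>: "\<psi> \<in> \<E>" and p: "p \<in> points N" for \<phi> \<psi> p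
  proof -
    obtain \<phi>1 \<phi>2 where \<phi>: "\<phi>1 \<in> \<E>1" "\<phi>2 \<in> \<E>2" "\<phi> = (\<lambda>(p1, p2). \<phi>1 p1 * \<phi>2 p2)"
      using \<phi> assms(6) by blast
    obtain \<psi>1 \<psi>2 where \<psi>: "\<psi>1 \<in> \<E>1" "\<psi>2 \<in> \<E>2" "\<psi> = (\<lambda>(p1, p2). \<psi>1 p1 * \<psi>2 p2)"
      using \<psi> assms(6) by blast
    obtain p1 p2 where p: "p = (p1, p2)" "p1 \<in> points M1" "p2 \<in> points M2"
      using p assms(3) by auto
    \<comment> \<open>Both summands contain the same four factors, with coefficients \<mu>1 and
      \<mu>2.\<close>
    show ?thesis
      using conformality_product[OF p(2,3), of \<phi>1 \<phi>2 \<psi>1 \<psi>2] E1 E2 \<phi> \<psi> p assms(3)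
      by (simp add: algebra_simps)
  qed
  show ?thesis
    using C T K by (simp add: eigenfamily_def mult.assoc)
qed

end
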